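(* Let $(M,g)$ be a transverse Riemann-Lorentz space with tangent radical and singular hypersurface $\Sigma$. Let $A,B\in\mathfrak{X}_\Sigma$ be such that $\mathrm{rank}(g_{A\wedge B})=1$ and $R\in A\wedge B$. Then $K_{A\wedge B}$ is not well-defined.
   Context: $M$ is a connected smooth manifold of dimension $m>2$ with a smooth symmetric $(0,2)$-tensor field $g=\langle\cdot,\cdot\rangle$ which fails to have maximal rank exactly on a nonempty set $\Sigma\subset M$. $(M,g)$ is a transverse singular space if in every local coordinate system $\det(g_{ab})$ has nonzero differential at the points of $\Sigma$; then $\Sigma$ is a smooth hypersurface (the singular hypersurface) and the radical $Rad_p=\{v\in T_pM: g(v,\cdot)=0\}$, $p\in\Sigma$, is one-dimensional. Tangent radical: $Rad_p\subset T_p\Sigma$ for all $p\in\Sigma$. Riemann-Lorentz: the signature of $g$ changes from Riemannian to Lorentzian across $\Sigma$. $\mathfrak{X}_\Sigma$: smooth vector fields along $\Sigma$; $\mathfrak{X}(\Sigma)$: those tangent to $\Sigma$. For $\mathcal A\in\mathfrak{X}(M)$, $\mathcal A^o=\mathcal A|_{M-\Sigma}$; $\mathcal A$ is an extension of $A=\mathcal A|_\Sigma$. Everything is local: $M$ may be replaced by a small neighbourhood of (a point of) $\Sigma$, and vector fields may be only locally defined. Dual connection: $2\square_{\mathcal A}\mathcal B(\mathcal C)=\mathcal A\langle\mathcal B,\mathcal C\rangle+\mathcal B\langle\mathcal C,\mathcal A\rangle-\mathcal C\langle\mathcal A,\mathcal B\rangle+\langle[\mathcal A,\mathcal B],\mathcal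 C\rangle-\langle[\mathcal B,\mathcal C],\mathcal A\rangle+\langle[\mathcal C,\mathcal A],\mathcal B\rangle$. For a radical vector field $R'$ along $\Sigma$, $II_{R'}(A,B):=\square_AB(R')$ is a well-defined symmetric $C^\infty(\Sigma)$-bilinear map on $\mathfrak{X}_\Sigma$. The main normal $N\in\mathfrak{X}_\Sigma$ satisfies $\langle N,T\Sigma\rangle=0$, $II_{R'}(N,N)=0$ for radical $R'$, $\langle N,N\rangle=1$ (unique up to sign). Second fundamental form: $\mathcal H(X,Y):=\square_XY(N)$, $X,Y\in\mathfrak{X}(\Sigma)$. The main radical vector field $R\in\mathfrak{X}(\Sigma)$ is in the radical distribution with $\mathcal H(R,R)=-1$ (unique up to sign, the sign of $N$ being chosen to make this possible). Let $\nabla$ be the Levi-Civita connection on $M-\Sigma$, with curvature $R(\mathcal A,\mathcal B)\mathcal C=\nabla_{\mathcal A}\nabla_{\mathcal B}\mathcal C-\nabla_{\mathcal B}\nabla_{\mathcal A}\mathcal C-\nabla_{[\mathcal A,\mathcal B]}\mathcal C$. $A\wedge B$ denotes the plane field spanned by linearly independent $A,B$, $g_{A\wedge B}$ the Gram matrix of $A,B$. Sectional curvature on $M-\Sigma$ near $\Sigma$ (paper's sign convention): $K_{\mathcal A^o\wedge\mathcal B^o}:=\langle R(\mathcal A^o,\mathcal B^o)\mathcal A^o,\mathcal B^o\rangle/\det(g_{\mathcal A^o\wedge\mathcal B^o})$ (for extensions of $A,B$ as in the claim, $\det(g_{\mathcal A\wedge\mathcal B})$ vanishes exactly to first order on $\Sigma$,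 so this is defined off $\Sigma$ near $\Sigma$). "$K_{A\wedge B}$ is well-defined" means: for all extensions $\mathcal A,\mathcal B$ of $A,B$, $K_{\mathcal A^o\wedge\mathcal B^o}$ extends smoothly across $\Sigma$, and the restriction to $\Sigma$ of this extension depends only on $A,B$. *)

theory Defs
  imports "HOL-Analysis.Analysis"
begin

section \<open>Smooth maps between Euclidean spaces\<close>

(* Meant for open S. In finite dimension, C^(k+1) means: differentiable with all directional
   derivatives of class C^k. *)
primrec Ck_on :: "nat \<Rightarrow> 'e::euclidean_space set \<Rightarrow> ('e \<Rightarrow> 'f::real_normed_vector) \<Rightarrow> bool" where
  "Ck_on 0 S f \<longleftrightarrow> continuous_on S f"
| "Ck_on (Suc k) S f \<longleftrightarrow> (\<forall>x\<in>S. f differentiable (at x)) \<and>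
     (\<forall>v. Ck_on k S (\<lambda>x. frechet_derivative f (at x) v))"

definition smooth_on :: "'e::euclidean_space set \<Rightarrow> ('e \<Rightarrow> 'f::real_normed_vector) \<Rightarrow> bool" where
  "smooth_on S f \<longleftrightarrow> (\<forall>k. Ck_on k S f)"


section \<open>Smooth manifolds of dimension \<open>CARD('m)\<close>\<close>

(* A chart is a pair (domain, coordinate map); values of the map off the domain are irrelevant. *)
type_synonym ('a, 'm) chart = "'a set \<times> ('a \<Rightarrow> real ^ 'm)"

abbreviation cdom :: "('a, 'm) chart \<Rightarrow> 'a set" where "cdom \<equiv> fst"
abbreviation cmap :: "('a, 'm) chart \<Rightarrow> 'a \<Rightarrow> real ^ 'm" where "cmap \<equiv> snd"

definition cinv :: "('a, 'm) chart \<Rightarrow> real ^ 'm \<Rightarrow> 'a" where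
  "cinv c = inv_into (cdom c) (cmap c)"

definition is_chart :: "('a::topological_space, 'm::finite) chart \<Rightarrow> bool" where
  "is_chart c \<longleftrightarrow> open (cdom c) \<and> open (cmap c ` cdom c) \<and>
     homeomorphism (cdom c) (cmap c ` cdom c) (cmap c) (cinv c)"

definition transition :: "('a, 'm) chart \<Rightarrow> ('a, 'm) chart \<Rightarrow> real ^ 'm \<Rightarrow> real ^ 'm" where
  "transition c d = cmap d \<circ> cinv c"

definition smooth_compatible :: "('a, 'm::finite) chart \<Rightarrow> ('a, 'm) chart \<Rightarrow> bool" where
  "smooth_compatible c d \<longleftrightarrow>
     smooth_on (cmap c ` (cdom c \<inter> cdom d)) (transition c d) \<and>
     smooth_on (cmap d ` (cdom c \<inter> cdom d)) (transition d c)"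

(* The manifold is the open set covered by the charts; Hausdorff and second countable via the
   type classes. *)
definition manifold_carrier :: "('a, 'm) chart set \<Rightarrow> 'a set" where
  "manifold_carrier \<Phi> = (\<Union>c\<in>\<Phi>. cdom c)"

definition smooth_structure ::
    "('a::{second_countable_topology, t2_space}, 'm::finite) chart set \<Rightarrow> bool" where
  "smooth_structure \<Phi> \<longleftrightarrow>
     (\<forall>c\<in>\<Phi>. is_chart c) \<and> (\<forall>c\<in>\<Phi>. \<forall>d\<in>\<Phi>. smooth_compatible c d) \<and>
     (\<forall>c. is_chart c \<and> cdom c \<subseteq> manifold_carrier \<Phi> \<and> (\<forall>d\<in>\<Phi>. smooth_compatible c d) \<longrightarrow> c \<in> \<Phi>)"

definition charts_at :: "('a, 'm) chart set \<Rightarrow> 'a \<Rightarrow> ('a, 'm) chart set" where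
  "charts_at \<Phi> p = {c\<in>\<Phi>. p \<in> cdom c}"

definition smooth_function_on :: "('a, 'm::finite) chart set \<Rightarrow> 'a set \<Rightarrow> ('a \<Rightarrow> real) \<Rightarrow> bool" where
  "smooth_function_on \<Phi> U f \<longleftrightarrow> (\<forall>c\<in>\<Phi>. smooth_on (cmap c ` (cdom c \<inter> U)) (f \<circ> cinv c))"


section \<open>Tensor fields, given by their components in every chart\<close>

(* A vector field X is represented by its components X c p in each chart c around p, subject to
   the transformation law; X c p is meaningful only for p in the domain of c. *)
type_synonym ('a, 'm) vfield = "('a, 'm) chart \<Rightarrow> 'a \<Rightarrow> real ^ 'm"

(* Likewise the matrices (g_ab) of a (0,2)-tensor field. *)
type_synonym ('a, 'm) tensor2 = "('a, 'm) chart \<Rightarrow> 'a \<Rightarrow> real ^ 'm ^ 'm"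

definition vector_field_on :: "('a, 'm::finite) chart set \<Rightarrow> 'a set \<Rightarrow> ('a, 'm) vfield \<Rightarrow> bool" where
  "vector_field_on \<Phi> V X \<longleftrightarrow>
     (\<forall>c\<in>\<Phi>. smooth_on (cmap c ` (cdom c \<inter> V)) (X c \<circ> cinv c)) \<and>
     (\<forall>p\<in>V. \<forall>c\<in>charts_at \<Phi> p. \<forall>d\<in>charts_at \<Phi> p.
        X d p = frechet_derivative (transition c d) (at (cmap c p)) (X c p))"

definition symmetric_tensor_field :: "('a, 'm::finite) chart set \<Rightarrow> ('a, 'm) tensor2 \<Rightarrow> bool" where
  "symmetric_tensor_field \<Phi> g \<longleftrightarrow>
     (\<forall>c\<in>\<Phi>. smooth_on (cmap c ` cdom c) (g c \<circ> cinv c)) \<and>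
     (\<forall>p. \<forall>c\<in>charts_at \<Phi> p. transpose (g c p) = g c p) \<and>
     (\<forall>p. \<forall>c\<in>charts_at \<Phi> p. \<forall>d\<in>charts_at \<Phi> p.
        let J = matrix (frechet_derivative (transition c d) (at (cmap c p)))
        in g c p = transpose J ** g d p ** J)"

definition metric :: "('a, 'm::finite) tensor2 \<Rightarrow> ('a, 'm) vfield \<Rightarrow> ('a, 'm) vfield \<Rightarrow>
    ('a, 'm) chart \<Rightarrow> 'a \<Rightarrow> real" where
  "metric g X Y c p = X c p \<bullet> (g c p *v Y c p)"

(* \<open>\<X>(p)\<close> applied to f, computed in the chart c. *)
definition dir_deriv :: "('a, 'm) chart \<Rightarrow> ('a, 'm::finite) vfield \<Rightarrow>
    ('a \<Rightarrow> 'f::real_normed_vector) \<Rightarrow> 'a \<Rightarrow> 'f" where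
  "dir_deriv c X f p = frechet_derivative (f \<circ> cinv c) (at (cmap c p)) (X c p)"

definition lie_bracket :: "('a, 'm::finite) vfield \<Rightarrow> ('a, 'm) vfield \<Rightarrow> ('a, 'm) vfield" where
  "lie_bracket X Y c p = dir_deriv c X (Y c) p - dir_deriv c Y (X c) p"


section \<open>Fields along a subset\<close>

(* X extends A from S to the open set V. *)
definition extension_on :: "('a::topological_space, 'm::finite) chart set \<Rightarrow> 'a set \<Rightarrow> 'a set \<Rightarrow>
    ('a, 'm) vfield \<Rightarrow> ('a, 'm) vfield \<Rightarrow> bool" where
  "extension_on \<Phi> S V A X \<longleftrightarrow> open V \<and> V \<subseteq> manifold_carrier \<Phi> \<and> vector_field_on \<Phi> V X \<and>
     (\<forall>p\<in>V \<inter> S. \<forall>c\<in>charts_at \<Phi> p. X c p = A c p)"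

(* Smoothness along S: locally the restriction of a smooth vector field on the manifold. *)
definition vector_field_along :: "('a::topological_space, 'm::finite) chart set \<Rightarrow> 'a set \<Rightarrow>
    ('a, 'm) vfield \<Rightarrow> bool" where
  "vector_field_along \<Phi> S A \<longleftrightarrow> (\<forall>p\<in>S. \<exists>V X. p \<in> V \<and> extension_on \<Phi> S V A X)"

(* Components in the chart c of the velocities at p of smooth curves in S. *)
definition tangent_space :: "'a set \<Rightarrow> ('a, 'm::finite) chart \<Rightarrow> 'a \<Rightarrow> (real ^ 'm) set" where
  "tangent_space S c p = {v. \<exists>\<gamma> e. e > 0 \<and> \<gamma> 0 = p \<and> (\<forall>t\<in>{-e<..<e}. \<gamma> t \<in> S \<inter> cdom c) \<and>
     smooth_on {-e<..<e} (cmap c \<circ> \<gamma>) \<and> ((cmap c \<circ> \<gamma>) has_vector_derivative v) (at (0::real))}"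

definition tangent_field_along :: "('a::topological_space, 'm::finite) chart set \<Rightarrow> 'a set \<Rightarrow>
    ('a, 'm) vfield \<Rightarrow> bool" where
  "tangent_field_along \<Phi> S X \<longleftrightarrow> vector_field_along \<Phi> S X \<and>
     (\<forall>p\<in>S. \<forall>c\<in>charts_at \<Phi> p. X c p \<in> tangent_space S c p)"


section \<open>Transverse singular spaces\<close>

definition singular_set :: "('a, 'm::finite) chart set \<Rightarrow> ('a, 'm) tensor2 \<Rightarrow> 'a set" where
  "singular_set \<Phi> g = {p \<in> manifold_carrier \<Phi>. \<exists>c\<in>charts_at \<Phi> p. rank (g c p) \<noteq> CARD('m)}"

definition transverse_singular_space ::
    "('a::{second_countable_topology, t2_space}, 'm::finite) chart set \<Rightarrow> ('a, 'm) tensor2 \<Rightarrow> bool" where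
  "transverse_singular_space \<Phi> g \<longleftrightarrow>
     smooth_structure \<Phi> \<and> connected (manifold_carrier \<Phi>) \<and> CARD('m) > 2 \<and>
     symmetric_tensor_field \<Phi> g \<and> singular_set \<Phi> g \<noteq> {} \<and>
     (\<forall>p\<in>singular_set \<Phi> g. \<forall>c\<in>charts_at \<Phi> p.
        \<exists>v. frechet_derivative (\<lambda>x. det (g c (cinv c x))) (at (cmap c p)) v \<noteq> 0)"

definition radical :: "('a, 'm::finite) tensor2 \<Rightarrow> ('a, 'm) chart \<Rightarrow> 'a \<Rightarrow> (real ^ 'm) set" where
  "radical g c p = {v. \<forall>w. v \<bullet> (g c p *v w) = 0}"

definition tangent_radical :: "('a, 'm::finite) chart set \<Rightarrow> ('a, 'm) tensor2 \<Rightarrow> bool" where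
  "tangent_radical \<Phi> g \<longleftrightarrow> (\<forall>p\<in>singular_set \<Phi> g. \<forall>c\<in>charts_at \<Phi> p.
     radical g c p \<subseteq> tangent_space (singular_set \<Phi> g) c p)"

(* Index of a symmetric bilinear form: maximal dimension of a negative definite subspace. *)
definition form_index :: "real ^ 'm ^ 'm \<Rightarrow> nat" where
  "form_index G = Max {dim S | S. subspace S \<and> (\<forall>v\<in>S - {0}. v \<bullet> (G *v v) < 0)}"

definition riemannian_at :: "('a, 'm::finite) chart set \<Rightarrow> ('a, 'm) tensor2 \<Rightarrow> 'a \<Rightarrow> bool" where
  "riemannian_at \<Phi> g p \<longleftrightarrow> (\<forall>c\<in>charts_at \<Phi> p. \<forall>v. v \<noteq> 0 \<longrightarrow> v \<bullet> (g c p *v v) > 0)"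

definition lorentzian_at :: "('a, 'm::finite) chart set \<Rightarrow> ('a, 'm) tensor2 \<Rightarrow> 'a \<Rightarrow> bool" where
  "lorentzian_at \<Phi> g p \<longleftrightarrow>
     (\<forall>c\<in>charts_at \<Phi> p. rank (g c p) = CARD('m) \<and> form_index (g c p) = 1)"

(* In the transverse case the complement of the singular hypersurface has locally two sides, on
   each of which the signature is constant; so one side is Riemannian and the other Lorentzian. *)
definition riemann_lorentz ::
    "('a::topological_space, 'm::finite) chart set \<Rightarrow> ('a, 'm) tensor2 \<Rightarrow> bool" where
  "riemann_lorentz \<Phi> g \<longleftrightarrow>
     (let M0 = manifold_carrier \<Phi> - singular_set \<Phi> g in
       (\<forall>p\<in>M0. riemannian_at \<Phi> g p \<or> lorentzian_at \<Phi> g p) \<and>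
       (\<forall>p\<in>singular_set \<Phi> g. p \<in> closure {q\<in>M0. riemannian_at \<Phi> g q} \<and>
                               p \<in> closure {q\<in>M0. lorentzian_at \<Phi> g q}))"


section \<open>Dual connection, main normal and main radical fields\<close>

definition dual_connection :: "('a, 'm::finite) tensor2 \<Rightarrow> ('a, 'm) vfield \<Rightarrow> ('a, 'm) vfield \<Rightarrow>
    ('a, 'm) vfield \<Rightarrow> ('a, 'm) chart \<Rightarrow> 'a \<Rightarrow> real" where
  "dual_connection g X Y Z c p =
     (dir_deriv c X (metric g Y Z c) p + dir_deriv c Y (metric g Z X c) p
      - dir_deriv c Z (metric g X Y c) p
      + metric g (lie_bracket X Y) Z c p - metric g (lie_bracket Y Z) X c p
      + metric g (lie_bracket Z X) Y c p) / 2"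

(* The value at p of the dual connection on fields A, B, C along S, when it does not depend on the
   extensions (nor on the chart). This gives the form II for C radical, and the second
   fundamental form for A, B tangent and C the main normal. *)
definition dual_connection_along :: "('a::topological_space, 'm::finite) chart set \<Rightarrow>
    ('a, 'm) tensor2 \<Rightarrow> 'a set \<Rightarrow> ('a, 'm) vfield \<Rightarrow> ('a, 'm) vfield \<Rightarrow> ('a, 'm) vfield \<Rightarrow> 'a \<Rightarrow> real" where
  "dual_connection_along \<Phi> g S A B C p =
     (THE r. \<forall>V X Y Z. p \<in> V \<and> extension_on \<Phi> S V A X \<and> extension_on \<Phi> S V B Y \<and>
        extension_on \<Phi> S V C Z \<longrightarrow> (\<forall>c\<in>charts_at \<Phi> p. dual_connection g X Y Z c p = r))"

definition radical_field_along :: "('a::topological_space, 'm::finite) chart set \<Rightarrow>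
    ('a, 'm) tensor2 \<Rightarrow> 'a set \<Rightarrow> ('a, 'm) vfield \<Rightarrow> bool" where
  "radical_field_along \<Phi> g S R \<longleftrightarrow> vector_field_along \<Phi> S R \<and>
     (\<forall>p\<in>S. \<forall>c\<in>charts_at \<Phi> p. R c p \<in> radical g c p)"

(* In the next two definitions S is a relatively open subset of the singular hypersurface. *)
definition main_normal :: "('a::topological_space, 'm::finite) chart set \<Rightarrow>
    ('a, 'm) tensor2 \<Rightarrow> 'a set \<Rightarrow> ('a, 'm) vfield \<Rightarrow> bool" where
  "main_normal \<Phi> g S N \<longleftrightarrow> vector_field_along \<Phi> S N \<and>
     (\<forall>p\<in>S. \<forall>c\<in>charts_at \<Phi> p.
        (\<forall>v\<in>tangent_space S c p. N c p \<bullet> (g c p *v v) = 0) \<and> metric g N N c p = 1) \<and>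
     (\<forall>R'. radical_field_along \<Phi> g S R' \<longrightarrow>
        (\<forall>p\<in>S. dual_connection_along \<Phi> g S N N R' p = 0))"

definition main_radical :: "('a::topological_space, 'm::finite) chart set \<Rightarrow>
    ('a, 'm) tensor2 \<Rightarrow> 'a set \<Rightarrow> ('a, 'm) vfield \<Rightarrow> ('a, 'm) vfield \<Rightarrow> bool" where
  "main_radical \<Phi> g S N R \<longleftrightarrow> tangent_field_along \<Phi> S R \<and> radical_field_along \<Phi> g S R \<and>
     (\<forall>p\<in>S. dual_connection_along \<Phi> g S R R N p = -1)"


section \<open>Levi-Civita connection and sectional curvature off the singular hypersurface\<close>

(* Koszul: \<open>\<langle>\<nabla>\<^sub>X Y, Z\<rangle>\<close> is the dual connection on X, Y, Z. That is tensorial in Z, so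
   the coordinate-constant fields Z suffice. Meaningful only where g is nondegenerate. *)
definition levi_civita :: "('a, 'm::finite) tensor2 \<Rightarrow> ('a, 'm) vfield \<Rightarrow> ('a, 'm) vfield \<Rightarrow>
    ('a, 'm) vfield" where
  "levi_civita g X Y c p =
     (THE v. \<forall>w. v \<bullet> (g c p *v w) = dual_connection g X Y (\<lambda>_ _. w) c p)"

definition curvature :: "('a, 'm::finite) tensor2 \<Rightarrow> ('a, 'm) vfield \<Rightarrow> ('a, 'm) vfield \<Rightarrow>
    ('a, 'm) vfield \<Rightarrow> ('a, 'm) vfield" where
  "curvature g X Y Z c p =
     levi_civita g X (levi_civita g Y Z) c p - levi_civita g Y (levi_civita g X Z) c p
     - levi_civita g (lie_bracket X Y) Z c p"

definition plane :: "('a, 'm::finite) vfield \<Rightarrow> ('a, 'm) vfield \<Rightarrow> ('a, 'm) chart \<Rightarrow> 'a \<Rightarrow>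
    (real ^ 'm) set" where
  "plane A B c p = span {A c p, B c p}"

definition gram :: "('a, 'm::finite) tensor2 \<Rightarrow> ('a, 'm) vfield \<Rightarrow> ('a, 'm) vfield \<Rightarrow>
    ('a, 'm) chart \<Rightarrow> 'a \<Rightarrow> real ^ 2 ^ 2" where
  "gram g A B c p = vector [vector [metric g A A c p, metric g A B c p],
                            vector [metric g B A c p, metric g B B c p]]"

definition sectional_curvature :: "('a, 'm::finite) tensor2 \<Rightarrow> ('a, 'm) vfield \<Rightarrow>
    ('a, 'm) vfield \<Rightarrow> ('a, 'm) chart \<Rightarrow> 'a \<Rightarrow> real" where
  "sectional_curvature g X Y c p = metric g (curvature g X Y X) Y c p / det (gram g X Y c p)"

(* Well-definedness over the open set U: there is one function k such that for all extensions X, Y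
   of A, B, possibly defined only on a smaller open set V, the sectional curvature extends
   smoothly across the singular set and the extension F restricts to k there. F has to agree
   with the curvature only where the latter is defined, i.e. where the Gram determinant is
   nonzero, and only near the singular set (on W). *)
definition curvature_well_defined :: "('a::topological_space, 'm::finite) chart set \<Rightarrow>
    ('a, 'm) tensor2 \<Rightarrow> 'a set \<Rightarrow> ('a, 'm) vfield \<Rightarrow> ('a, 'm) vfield \<Rightarrow> bool" where
  "curvature_well_defined \<Phi> g U A B \<longleftrightarrow>
     (let S = singular_set \<Phi> g in
      \<exists>k. \<forall>V X Y. V \<subseteq> U \<and> extension_on \<Phi> S V A X \<and> extension_on \<Phi> S V B Y \<longrightarrow>
        (\<exists>W F. open W \<and> V \<inter> S \<subseteq> W \<and> W \<subseteq> V \<and> smooth_function_on \<Phi> W F \<and>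
           (\<forall>q\<in>W - S. \<forall>c\<in>charts_at \<Phi> q.
              det (gram g X Y c q) \<noteq> 0 \<longrightarrow> F q = sectional_curvature g X Y c q) \<and>
           (\<forall>q\<in>V \<inter> S. F q = k q)))"

end

theory Submission
  imports Defs
begin

text \<open>
Since \<open>g\<close> is a limit of Riemannian metrics at a point \<open>p\<close> of the singular hypersurface, it is positive
semidefinite there, so the plane of \<open>A, B\<close> contains a radical vector \<open>u = a A + b B \<noteq> 0\<close>. In a chart
around \<open>p\<close> put \<open>\<tau> = det g\<close> and choose a constant vector \<open>z\<close> with \<open>d\<tau>(z) \<noteq> 0\<close>. Given extensions \<open>X, Y\<close>,
also \<open>X + s b \<tau> z, Y - s a \<tau> z\<close> are extensions for every real \<open>s\<close>, with wedge product
\<open>X \<and> Y + s \<tau> z \<and> v\<close>, where \<open>v = a X + b Y\<close>. Their Gram determinants have the same nonzero derivative at \<open>p\<close>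
along the line \<open>p + t z\<close>. If the curvatures had the same limit at \<open>p\<close> for \<open>s = -1, 0, 1\<close>, the second
difference \<open>2 \<tau>\<^sup>2 \<langle>R(z, v)z, v\<rangle>\<close> of the numerators would thus be \<open>o(t)\<close>. But \<open>g\<inverse>\<close> has a pole in the radical
direction, and \<open>\<tau> \<langle>R(z, v)z, v\<rangle>\<close> tends to \<open>- d\<tau>(z) (\<partial>\<^sub>z g)(u, u) / 4 \<noteq> 0\<close>; here the tangency of the
radical gives \<open>(\<partial>\<^sub>u g)(u, u) = 0\<close>, which removes the other polar term.
\<close>

section \<open>Calculus of \<open>Ck_on\<close>\<close>

text \<open>The perturbation must vanish on the singular hypersurface to give an extension again, so
  it carries a factor \<open>det g\<close>, and the quadratic term of the numerator carries
  \<open>(det g)^2\<close>. One of these factors absorbs the simple pole of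
  \<open>riem(z, v, z, v)\<close>, which is present because v becomes radical at p; the other is of
  first order, like the Gram determinant, so the effect survives in the quotient. The second
  difference in s discards the terms of order 0 and 1, which involve the arbitrary fields X, Y and
  over which there is no control. An obstacle is that covariant derivatives are given only
  implicitly and only off the hypersurface, while the limit is taken at a point on it. All
  computations therefore use Christoffel symbols with lowered index, which are smooth across the
  hypersurface. The inverse metric then enters the curvature through two explicit terms, and its
  growth is read off from Cramer's rule.\<close>

lemma Ck_on_SucD: "Ck_on (Suc k) S f \<Longrightarrow> Ck_on k S f"
proof (induction k arbitrary: f)
  case 0
  then show ?case
    by (auto intro!: differentiable_imp_continuous_on differentiable_at_imp_differentiable_on)
next
  case (Suc k)
  then show ?case by simp
qed

lemma Ck_on_subset: "Ck_on k S f \<Longrightarrow> T \<subseteq> S \<Longrightarrow> Ck_on k T f"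
  by (induction k arbitrary: f) (auto intro: continuous_on_subset)

lemma Ck_on_cong:
  assumes "open S" "\<And>x. x \<in> S \<Longrightarrow> f x = h x" "Ck_on k S f"
  shows "Ck_on k S h"
  using assms(2,3)
proof (induction k arbitrary: f h)
  case 0
  then show ?case by (metis Ck_on.simps(1) continuous_on_cong)
next
  case (Suc k)
  have d: "h differentiable at x" if "x \<in> S" for x
    using Suc.prems that assms(1)
    by (metis Ck_on.simps(2) differentiable_def has_derivative_transform_within_open)
  have "Ck_on k S (\<lambda>x. frechet_derivative h (at x) v)" for v
  proof (rule Suc.IH)
    show "Ck_on k S (\<lambda>x. frechet_derivative f (at x) v)"
      using Suc.prems by simp
    show "frechet_derivative f (at x) v = frechet_derivative h (at x) v" if "x \<in> S" for x
      using frechet_derivative_transform_within_open[OF _ assms(1) that Suc.prems(1)] Suc.prems(2) that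
      by simp
  qed
  with d show ?case by simp
qed

text \<open>Lets the inductions below work with an explicit derivative; openness of \<open>S\<close>
  allows \<open>frechet_derivative f\<close> to be replaced by it through
  \<open>Ck_on_cong\<close>.\<close>

lemma Ck_on_SucI:
  assumes "open S" "\<And>x. x \<in> S \<Longrightarrow> (f has_derivative f' x) (at x)"
    and "\<And>v. Ck_on k S (\<lambda>x. f' x v)"
  shows "Ck_on (Suc k) S f"
proof -
  have "Ck_on k S (\<lambda>x. frechet_derivative f (at x) v)" for v
    by (rule Ck_on_cong[OF assms(1) _ assms(3)[of v]])
      (simp add: frechet_derivative_at[OF assms(2), symmetric])
  then show ?thesis using assms(2) by (auto intro: differentiableI)
qed

lemma Ck_on_Suc_has_derivative:
  "Ck_on (Suc k) S f \<Longrightarrow> x \<in> S \<Longrightarrow> (f has_derivative frechet_derivative f (at x)) (at x)"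
  using frechet_derivative_works by auto

lemma Ck_on_const: "open S \<Longrightarrow> Ck_on k S (\<lambda>x. a)"
  by (induction k arbitrary: a) auto

lemma Ck_on_linear_compose:
  assumes "open S" "bounded_linear L" "Ck_on k S f"
  shows "Ck_on k S (\<lambda>x. L (f x))"
  using assms(3)
proof (induction k arbitrary: f)
  case 0
  then show ?case
    by (simp add: bounded_linear.continuous_on[OF assms(2)])
next
  case (Suc k)
  show ?case
    by (rule Ck_on_SucI[OF assms(1) bounded_linear.has_derivative[OF assms(2)
          Ck_on_Suc_has_derivative[OF Suc.prems]]])
      (use Suc in auto)
qed

lemma Ck_on_add:
  assumes "open S" "Ck_on k S f" "Ck_on k S h"
  shows "Ck_on k S (\<lambda>x. f x + h x)"
  using assms(2,3)
proof (induction k arbitrary: f h)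
  case 0
  then show ?case by (simp add: continuous_on_add)
next
  case (Suc k)
  show ?case
    by (rule Ck_on_SucI[OF assms(1) has_derivative_add[OF Ck_on_Suc_has_derivative[OF Suc.prems(1)]
          Ck_on_Suc_has_derivative[OF Suc.prems(2)]]])
      (use Suc in auto)
qed

lemma Ck_on_sum:
  assumes "open S" "\<And>i. i \<in> I \<Longrightarrow> Ck_on k S (f i)"
  shows "Ck_on k S (\<lambda>x. \<Sum>i\<in>I. f i x)"
  using assms(2)
  by (induction I rule: infinite_finite_induct)
    (auto intro!: Ck_on_add[OF assms(1)] Ck_on_const[OF assms(1)])

lemma Ck_on_bilinear:
  assumes "open S" "bounded_bilinear B" "Ck_on k S f" "Ck_on k S h"
  shows "Ck_on k S (\<lambda>x. B (f x) (h x))"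
  using assms(3,4)
proof (induction k arbitrary: f h)
  case 0
  then show ?case by (simp add: bounded_bilinear.continuous_on[OF assms(2)])
next
  case (Suc k)
  show ?case
    by (rule Ck_on_SucI[OF assms(1) bounded_bilinear.FDERIV[OF assms(2)
          Ck_on_Suc_has_derivative[OF Suc.prems(1)] Ck_on_Suc_has_derivative[OF Suc.prems(2)]]])
      (use Suc Ck_on_SucD[OF Suc.prems(1)] Ck_on_SucD[OF Suc.prems(2)]
        in \<open>auto intro!: Ck_on_add[OF assms(1)]\<close>)
qed

lemma Ck_on_prod:
  fixes f :: "'i \<Rightarrow> 'e::euclidean_space \<Rightarrow> real"
  assumes "open S" "\<And>i. i \<in> I \<Longrightarrow> Ck_on k S (f i)"
  shows "Ck_on k S (\<lambda>x. \<Prod>i\<in>I. f i x)"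
  using assms(2)
  by (induction I rule: infinite_finite_induct)
    (auto intro!: Ck_on_bilinear[OF assms(1) bounded_bilinear_mult] Ck_on_const[OF assms(1)])

lemma linear_sum_Basis:
  assumes "linear L"
  shows "L v = (\<Sum>b\<in>Basis. (v \<bullet> b) *\<^sub>R L b)"
  by (metis (no_types, lifting) assms euclidean_representation linear_cmul linear_sum sum.cong)

lemma Ck_on_compose:
  fixes f :: "'d::euclidean_space \<Rightarrow> 'f::real_normed_vector" and h :: "'e::euclidean_space \<Rightarrow> 'd"
  assumes "open S" "h ` S \<subseteq> T" "Ck_on k T f" "Ck_on k S h"
  shows "Ck_on k S (\<lambda>x. f (h x))"
  using assms(3,4)
proof (induction k arbitrary: f)
  case 0
  then show ?case using assms(2) by (auto intro: continuous_on_compose2)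
next
  case (Suc k)
  let ?Df = "\<lambda>y. frechet_derivative f (at y)"
  let ?Dh = "\<lambda>x. frechet_derivative h (at x)"
  have d: "((\<lambda>x. f (h x)) has_derivative (\<lambda>v. ?Df (h x) (?Dh x v))) (at x)" if "x \<in> S" for x
    using diff_chain_at[OF Ck_on_Suc_has_derivative[OF Suc.prems(2) that]
        Ck_on_Suc_has_derivative[OF Suc.prems(1), of "h x"]] that assms(2)
    by (auto simp: o_def)
  \<comment> \<open>The derivative of \<open>f\<close> is applied to a vector that varies with
    \<open>x\<close>, so the induction hypothesis does not apply directly. Expanding that vector in
    \<open>Basis\<close> leaves functions \<open>frechet_derivative f (at y) b\<close> with fixed
    \<open>b\<close>, composed with \<open>h\<close>.\<close>
  have e: "?Df (h x) (?Dh x v) = (\<Sum>b\<in>Basis. (?Dh x v \<bullet> b) *\<^sub>R ?Df (h x) b)" if "x \<in> S" for x v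
    by (rule linear_sum_Basis, rule linear_frechet_derivative) (use that Suc.prems assms(2) in auto)
  have "Ck_on k S (\<lambda>x. ?Df (h x) (?Dh x v))" for v
  proof (rule Ck_on_cong[OF assms(1) e[symmetric]])
    show "Ck_on k S (\<lambda>x. \<Sum>b\<in>Basis. (?Dh x v \<bullet> b) *\<^sub>R ?Df (h x) b)"
      by (intro Ck_on_sum assms(1) Ck_on_bilinear[OF _ bounded_bilinear_scaleR]
          Ck_on_linear_compose[OF _ bounded_linear_inner_left])
        (use Suc Ck_on_SucD[OF Suc.prems(2)] in auto)
  qed auto
  from Ck_on_SucI[OF assms(1) d this] show ?case .
qed

lemma bounded_linear_matrix_entry: "bounded_linear (\<lambda>A::real^'n^'m. A $ i $ j)"
  using bounded_linear_compose[OF bounded_linear_vec_nth bounded_linear_vec_nth] .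

lemma Ck_on_det:
  fixes A :: "'e::euclidean_space \<Rightarrow> real^'n^'n"
  assumes "open S" "Ck_on k S A"
  shows "Ck_on k S (\<lambda>x. det (A x))"
  unfolding det_def
  by (intro Ck_on_sum Ck_on_bilinear[OF _ bounded_bilinear_mult] Ck_on_const Ck_on_prod assms
      Ck_on_linear_compose[OF _ bounded_linear_matrix_entry])

lemma smooth_on_subset: "smooth_on S f \<Longrightarrow> T \<subseteq> S \<Longrightarrow> smooth_on T f"
  unfolding smooth_on_def using Ck_on_subset by blast

lemma smooth_on_cong: "open S \<Longrightarrow> smooth_on S f \<Longrightarrow> (\<And>x. x \<in> S \<Longrightarrow> f x = h x) \<Longrightarrow> smooth_on S h"
  unfolding smooth_on_def using Ck_on_cong by blast

lemma smooth_on_continuous: "smooth_on S f \<Longrightarrow> continuous_on S f"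
  unfolding smooth_on_def by (metis Ck_on.simps(1))

lemma smooth_on_has_derivative:
  "smooth_on S f \<Longrightarrow> x \<in> S \<Longrightarrow> (f has_derivative frechet_derivative f (at x)) (at x)"
  unfolding smooth_on_def using Ck_on_Suc_has_derivative by blast

lemma smooth_on_linear_frechet:
  "smooth_on S f \<Longrightarrow> x \<in> S \<Longrightarrow> linear (frechet_derivative f (at x))"
  using smooth_on_has_derivative has_derivative_linear by blast

lemma smooth_on_frechet_derivative:
  "smooth_on S f \<Longrightarrow> smooth_on S (\<lambda>x. frechet_derivative f (at x) v)"
  unfolding smooth_on_def by (metis Ck_on.simps(2))

section \<open>Symmetry of second derivatives\<close>

lemma mixed_difference:
  fixes f :: "'e::euclidean_space \<Rightarrow> real"
  assumes "0 < h"
    and d1: "\<And>s t. 0 \<le> s \<Longrightarrow> s \<le> h \<Longrightarrow> 0 \<le> t \<Longrightarrow> t \<le> h \<Longrightarrow>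
        (f has_derivative f' (x + s *\<^sub>R u + t *\<^sub>R v)) (at (x + s *\<^sub>R u + t *\<^sub>R v))"
    and d2: "\<And>s t. 0 \<le> s \<Longrightarrow> s \<le> h \<Longrightarrow> 0 \<le> t \<Longrightarrow> t \<le> h \<Longrightarrow>
        ((\<lambda>y. f' y u) has_derivative f'' (x + s *\<^sub>R u + t *\<^sub>R v)) (at (x + s *\<^sub>R u + t *\<^sub>R v))"
  shows "\<exists>s t. 0 < s \<and> s < h \<and> 0 < t \<and> t < h \<and>
    f (x + h *\<^sub>R u + h *\<^sub>R v) - f (x + h *\<^sub>R u) - f (x + h *\<^sub>R v) + f x
      = h * h * f'' (x + s *\<^sub>R u + t *\<^sub>R v) v"
proof -
  have D1: "((\<lambda>s. f (x + s *\<^sub>R u + t *\<^sub>R v)) has_real_derivative f' (x + s *\<^sub>R u + t *\<^sub>R v) u) (at s)"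
    if "0 \<le> s" "s \<le> h" "0 \<le> t" "t \<le> h" for s t
  proof -
    have "((\<lambda>s. x + s *\<^sub>R u + t *\<^sub>R v) has_derivative (\<lambda>r. r *\<^sub>R u)) (at s)"
      by (auto intro!: derivative_eq_intros)
    from diff_chain_at[OF this d1[OF that]] show ?thesis
      using linear_cmul[OF has_derivative_linear[OF d1[OF that]]]
      by (simp add: has_field_derivative_def o_def mult_commute_abs)
  qed
  have D2: "((\<lambda>t. f' (x + s *\<^sub>R u + t *\<^sub>R v) u) has_real_derivative f'' (x + s *\<^sub>R u + t *\<^sub>R v) v) (at t)"
    if "0 \<le> s" "s \<le> h" "0 \<le> t" "t \<le> h" for s t
  proof -
    have "((\<lambda>t. x + s *\<^sub>R u + t *\<^sub>R v) has_derivative (\<lambda>r. r *\<^sub>R v)) (at t)"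
      by (auto intro!: derivative_eq_intros)
    from diff_chain_at[OF this d2[OF that]] show ?thesis
      using linear_cmul[OF has_derivative_linear[OF d2[OF that]]]
      by (simp add: has_field_derivative_def o_def mult_commute_abs)
  qed
  \<comment> \<open>The mean value theorem is applied to this difference in \<open>s\<close>, and
    then to the resulting difference of derivatives in \<open>t\<close>. The summand
    \<open>0 *\<^sub>R v\<close> is kept so that \<open>D1\<close> fits with
    \<open>t = 0\<close>.\<close>
  let ?a = "\<lambda>s. f (x + s *\<^sub>R u + h *\<^sub>R v) - f (x + s *\<^sub>R u + 0 *\<^sub>R v)"
  have "\<exists>s>0. s < h \<and> ?a h - ?a 0
      = (h - 0) * (f' (x + s *\<^sub>R u + h *\<^sub>R v) u - f' (x + s *\<^sub>R u + 0 *\<^sub>R v) u)"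
    by (rule MVT2[OF assms(1)], rule DERIV_diff; rule D1) (use assms(1) in auto)
  then obtain s where s: "0 < s" "s < h" "?a h - ?a 0
      = h * (f' (x + s *\<^sub>R u + h *\<^sub>R v) u - f' (x + s *\<^sub>R u + 0 *\<^sub>R v) u)"
    by auto
  have "\<exists>t>0. t < h \<and> f' (x + s *\<^sub>R u + h *\<^sub>R v) u - f' (x + s *\<^sub>R u + 0 *\<^sub>R v) u
      = (h - 0) * f'' (x + s *\<^sub>R u + t *\<^sub>R v) v"
    by (rule MVT2[OF assms(1)], rule D2) (use s in auto)
  then obtain t where "0 < t" "t < h" "f' (x + s *\<^sub>R u + h *\<^sub>R v) u - f' (x + s *\<^sub>R u + 0 *\<^sub>R v) u
      = (h - 0) * f'' (x + s *\<^sub>R u + t *\<^sub>R v) v" by blast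
  with s show ?thesis by (intro exI[of _ s] exI[of _ t]) (simp add: algebra_simps)
qed

text \<open>The second difference over a small parallelogram does not depend on the order of
  \<open>u\<close> and \<open>v\<close>, and \<open>mixed_difference\<close> equates it, up to the
  factor \<open>h * h\<close>, with either mixed derivative at a nearby point. Continuity moves the
  equality to \<open>x\<close>.\<close>

lemma symmetric_second_derivative_real:
  fixes f :: "'e::euclidean_space \<Rightarrow> real"
  assumes "open S" "x \<in> S" "smooth_on S f"
  shows "frechet_derivative (\<lambda>y. frechet_derivative f (at y) u) (at x) v =
         frechet_derivative (\<lambda>y. frechet_derivative f (at y) v) (at x) u"
proof -
  define F where "F u v y = frechet_derivative (\<lambda>y. frechet_derivative f (at y) u) (at y) v" for u v y
  have cont: "isCont (F u v) x" for u v
  proof -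
    have "smooth_on S (F u v)"
      unfolding F_def using assms(3) smooth_on_frechet_derivative by blast
    from smooth_on_continuous[OF this] show ?thesis
      using assms(1,2) continuous_on_eq_continuous_at by blast
  qed
  obtain r where r: "r > 0" "ball x r \<subseteq> S" using assms(1,2) open_contains_ball by blast
  have "\<bar>F u v x - F v u x\<bar> < e" if "e > 0" for e
  proof -
    obtain r1 where r1: "r1 > 0" "\<And>y. dist y x < r1 \<Longrightarrow> dist (F u v y) (F u v x) < e/2"
      using cont[of u v] \<open>e > 0\<close> unfolding continuous_at_eps_delta by (meson half_gt_zero)
    obtain r2 where r2: "r2 > 0" "\<And>y. dist y x < r2 \<Longrightarrow> dist (F v u y) (F v u x) < e/2"
      using cont[of v u] \<open>e > 0\<close> unfolding continuous_at_eps_delta by (meson half_gt_zero)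
    define d where "d = min r (min r1 r2)"
    \<comment> \<open>Small enough for the whole parallelogram to lie within distance
      \<open>d\<close> of \<open>x\<close>; the summand 1 covers \<open>u = v = 0\<close>.\<close>
    define h where "h = d / (2 * (norm u + norm v + 1))"
    have d: "d > 0" using r r1 r2 by (simp add: d_def)
    have h: "h > 0" unfolding h_def using d
      by (intro divide_pos_pos) (auto simp: add_nonneg_pos)
    have hd: "h * (norm u + norm v) < d"
    proof -
      have "h * (norm u + norm v) \<le> h * (norm u + norm v + 1)" using h by simp
      also have "\<dots> = d / 2"
      proof -
        have "norm u + norm v + 1 > 0" by (simp add: add_nonneg_pos)
        then show ?thesis unfolding h_def by (simp add: field_simps)
      qed
      also have "\<dots> < d" using d by simp
      finally show ?thesis .
    qed
    have near: "dist (x + s *\<^sub>R u + t *\<^sub>R v) x < d"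
      if "0 \<le> s" "s \<le> h" "0 \<le> t" "t \<le> h" for s t
    proof -
      have "norm (s *\<^sub>R u + t *\<^sub>R v) \<le> s * norm u + t * norm v"
        using that norm_triangle_ineq[of "s *\<^sub>R u" "t *\<^sub>R v"] by simp
      also have "\<dots> \<le> h * norm u + h * norm v"
        using that by (intro add_mono mult_right_mono) auto
      finally show ?thesis using hd by (simp add: dist_norm algebra_simps)
    qed
    have near': "dist (x + s *\<^sub>R v + t *\<^sub>R u) x < d"
      if "0 \<le> s" "s \<le> h" "0 \<le> t" "t \<le> h" for s t
      using near[OF that(3,4,1,2)] by (simp add: algebra_simps)
    have inS: "y \<in> S" if "dist y x < d" for y
      using that r by (auto simp: d_def dist_commute subset_iff)
    have D1: "(f has_derivative frechet_derivative f (at y)) (at y)" if "y \<in> S" for y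
      using smooth_on_has_derivative[OF assms(3) that] .
    have D2: "((\<lambda>y. frechet_derivative f (at y) w) has_derivative
        frechet_derivative (\<lambda>y. frechet_derivative f (at y) w) (at y)) (at y)" if "y \<in> S" for y w
      using smooth_on_has_derivative[OF smooth_on_frechet_derivative[OF assms(3)] that] .
    obtain s t where st: "0 < s" "s < h" "0 < t" "t < h"
      "f (x + h *\<^sub>R u + h *\<^sub>R v) - f (x + h *\<^sub>R u) - f (x + h *\<^sub>R v) + f x
        = h * h * F u v (x + s *\<^sub>R u + t *\<^sub>R v)"
      using mixed_difference[OF h D1[OF inS[OF near]] D2[OF inS[OF near]]]
      unfolding F_def by auto
    obtain s' t' where st': "0 < s'" "s' < h" "0 < t'" "t' < h"
      "f (x + h *\<^sub>R v + h *\<^sub>R u) - f (x + h *\<^sub>R v) - f (x + h *\<^sub>R u) + f x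
        = h * h * F v u (x + s' *\<^sub>R v + t' *\<^sub>R u)"
      using mixed_difference[OF h D1[OF inS[OF near']] D2[OF inS[OF near']]]
      unfolding F_def by auto
    have "h * h * F u v (x + s *\<^sub>R u + t *\<^sub>R v) = h * h * F v u (x + s' *\<^sub>R v + t' *\<^sub>R u)"
      using st(5) st'(5) by (simp add: algebra_simps)
    then have eq: "F u v (x + s *\<^sub>R u + t *\<^sub>R v) = F v u (x + s' *\<^sub>R v + t' *\<^sub>R u)"
      using h by simp
    have "dist (F u v (x + s *\<^sub>R u + t *\<^sub>R v)) (F u v x) < e/2"
      using r1(2) near[of s t] st by (simp add: d_def)
    moreover have "dist (F v u (x + s' *\<^sub>R v + t' *\<^sub>R u)) (F v u x) < e/2"
      using r2(2) near'[of s' t'] st' by (simp add: d_def)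
    ultimately show ?thesis unfolding eq dist_real_def by linarith
  qed
  from this[of "\<bar>F u v x - F v u x\<bar>"] have "F u v x = F v u x" by force
  then show ?thesis unfolding F_def .
qed

text \<open>Pairing with a fixed \<open>w\<close> reduces this to real-valued functions. It will be
  applied to the matrix-valued metric and to the component vectors of fields.\<close>

lemma symmetric_second_derivative:
  fixes f :: "'e::euclidean_space \<Rightarrow> 'f::real_inner"
  assumes "open S" "x \<in> S" "smooth_on S f"
  shows "frechet_derivative (\<lambda>y. frechet_derivative f (at y) u) (at x) v =
         frechet_derivative (\<lambda>y. frechet_derivative f (at y) v) (at x) u"
proof -
  have D: "frechet_derivative (\<lambda>y. frechet_derivative f (at y) u) (at x) v \<bullet> w =
      frechet_derivative (\<lambda>y. frechet_derivative (\<lambda>y. f y \<bullet> w) (at y) u) (at x) v" for u v w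
  proof -
    have 1: "frechet_derivative (\<lambda>y. f y \<bullet> w) (at y) u = frechet_derivative f (at y) u \<bullet> w" if "y \<in> S" for y
      using frechet_derivative_at[OF bounded_linear.has_derivative[OF bounded_linear_inner_left
            smooth_on_has_derivative[OF assms(3) that]], of w]
      by (rule fun_cong[symmetric])
    have 2: "((\<lambda>y. frechet_derivative f (at y) u \<bullet> w) has_derivative
        (\<lambda>v. frechet_derivative (\<lambda>y. frechet_derivative f (at y) u) (at x) v \<bullet> w)) (at x)"
      by (rule bounded_linear.has_derivative[OF bounded_linear_inner_left
            smooth_on_has_derivative[OF smooth_on_frechet_derivative[OF assms(3)] assms(2)]])
    have "((\<lambda>y. frechet_derivative (\<lambda>y. f y \<bullet> w) (at y) u) has_derivative
        (\<lambda>v. frechet_derivative (\<lambda>y. frechet_derivative f (at y) u) (at x) v \<bullet> w)) (at x)"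
      by (rule has_derivative_transform_within_open[OF 2 assms(1,2)]) (simp add: 1)
    from frechet_derivative_at[OF this] show ?thesis by (rule fun_cong)
  qed
  have "smooth_on S (\<lambda>y. f y \<bullet> w)" for w
    using assms(3) unfolding smooth_on_def
    by (auto intro!: Ck_on_linear_compose[OF assms(1) bounded_linear_inner_left])
  note trans[OF D trans[OF symmetric_second_derivative_real[OF assms(1,2) this] D[symmetric]]]
  then show ?thesis by (rule iffD1[OF vector_eq_rdot, OF allI])
qed

section \<open>Linear maps and linear systems that vary with the point\<close>

lemma bounded_bilinear_matrix_vector_mult:
  "bounded_bilinear ((*v) :: real^'n^'m \<Rightarrow> real^'n \<Rightarrow> real^'m)"
  unfolding bilinear_conv_bounded_bilinear[symmetric] bilinear_def
  by (auto intro!: linearI simp: matrix_vector_right_distrib matrix_vector_mult_add_rdistrib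
      scaleR_matrix_vector_assoc matrix_vector_mult_scaleR)

lemma inner_matrix_transpose: "x \<bullet> (A *v y) = y \<bullet> (transpose A *v (x::real^'n))"
  by (metis dot_lmul_matrix inner_commute transpose_matrix_vector)

text \<open>A product rule when derivatives of \<open>L\<close> are known only for fixed vectors. In
  finite dimension, expanding \<open>f y\<close> in \<open>Basis\<close> reduces it to the rule for
  scalar multiples.\<close>

lemma has_derivative_family_apply:
  fixes L :: "'d::euclidean_space \<Rightarrow> 'a::euclidean_space \<Rightarrow> 'c::real_normed_vector"
  assumes "open S" "x \<in> S" "\<And>y. y \<in> S \<Longrightarrow> linear (L y)"
    and L': "\<And>v. ((\<lambda>y. L y v) has_derivative L' v) (at x)"
    and f': "(f has_derivative f') (at x)"
  shows "((\<lambda>y. L y (f y)) has_derivative (\<lambda>h. L' (f x) h + L x (f' h))) (at x)"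
proof -
  have "((\<lambda>y. \<Sum>b\<in>Basis. (f x \<bullet> b) *\<^sub>R L y b) has_derivative
      (\<lambda>h. \<Sum>b\<in>Basis. (f x \<bullet> b) *\<^sub>R L' b h)) (at x)"
    by (intro has_derivative_sum has_derivative_scaleR_right L')
  then have "((\<lambda>y. L y (f x)) has_derivative (\<lambda>h. \<Sum>b\<in>Basis. (f x \<bullet> b) *\<^sub>R L' b h)) (at x)"
    by (rule has_derivative_transform_within_open[OF _ assms(1,2)])
      (use linear_sum_Basis[OF assms(3)] in auto)
  \<comment> \<open>\<open>L'\<close> is not assumed linear in its first argument; uniqueness of the
    derivative supplies its expansion at \<open>f x\<close>.\<close>
  then have 1: "L' (f x) = (\<lambda>h. \<Sum>b\<in>Basis. (f x \<bullet> b) *\<^sub>R L' b h)"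
    using L' has_derivative_unique by blast
  have "((\<lambda>y. \<Sum>b\<in>Basis. (f y \<bullet> b) *\<^sub>R L y b) has_derivative
      (\<lambda>h. \<Sum>b\<in>Basis. (f x \<bullet> b) *\<^sub>R L' b h + (f' h \<bullet> b) *\<^sub>R L x b)) (at x)"
    by (intro has_derivative_sum has_derivative_scaleR L' has_derivative_inner_left f')
  also have "(\<lambda>h. \<Sum>b\<in>Basis. (f x \<bullet> b) *\<^sub>R L' b h + (f' h \<bullet> b) *\<^sub>R L x b)
      = (\<lambda>h. L' (f x) h + L x (f' h))"
    by (rule ext, subst linear_sum_Basis[OF assms(3)[OF assms(2)]]) (simp add: 1 sum.distrib)
  finally show ?thesis
    by (rule has_derivative_transform_within_open[OF _ assms(1,2)])
      (use linear_sum_Basis[OF assms(3)] in auto)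
qed

lemma tendsto_family_apply:
  fixes L :: "'t \<Rightarrow> 'a::euclidean_space \<Rightarrow> 'c::real_normed_vector"
  assumes "eventually (\<lambda>t. linear (L t)) F" "linear L0"
    and "\<And>b. b \<in> Basis \<Longrightarrow> ((\<lambda>t. L t b) \<longlongrightarrow> L0 b) F" "(v \<longlongrightarrow> v0) F"
  shows "((\<lambda>t. L t (v t)) \<longlongrightarrow> L0 v0) F"
proof -
  have "((\<lambda>t. \<Sum>b\<in>Basis. (v t \<bullet> b) *\<^sub>R L t b) \<longlongrightarrow> (\<Sum>b\<in>Basis. (v0 \<bullet> b) *\<^sub>R L0 b)) F"
    by (intro tendsto_intros assms)
  moreover have "eventually (\<lambda>t. (\<Sum>b\<in>Basis. (v t \<bullet> b) *\<^sub>R L t b) = L t (v t)) F"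
    using assms(1) by eventually_elim (rule linear_sum_Basis[symmetric])
  ultimately show ?thesis
    using tendsto_cong linear_sum_Basis[OF assms(2), of v0] by force
qed

lemma differentiable_prod:
  fixes f :: "'i \<Rightarrow> 'a::real_normed_vector \<Rightarrow> real"
  assumes "\<And>i. i \<in> I \<Longrightarrow> f i differentiable (at x)"
  shows "(\<lambda>x. \<Prod>i\<in>I. f i x) differentiable (at x)"
  using assms by (induction I rule: infinite_finite_induct) auto

lemma differentiable_det:
  fixes A :: "'a::real_normed_vector \<Rightarrow> real^'n^'n"
  assumes "\<And>i j. (\<lambda>x. A x $ i $ j) differentiable (at x)"
  shows "(\<lambda>x. det (A x)) differentiable (at x)"
  unfolding det_def
  by (intro differentiable_sum differentiable_mult differentiable_const differentiable_prod assms
      ballI finite_permutations finite)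

text \<open>Covariant derivatives are known only as solutions of a linear system with the metric as
  matrix. Cramer's rule writes a solution as quotients of determinants, so it inherits
  differentiability.\<close>

lemma differentiable_solution:
  fixes A :: "real^'n \<Rightarrow> real^'n^'n"
  assumes "open S" "x \<in> S" "A differentiable (at x)" "w differentiable (at x)"
    and "\<And>y. y \<in> S \<Longrightarrow> A y *v P y = w y" "\<And>y. y \<in> S \<Longrightarrow> det (A y) \<noteq> 0"
  shows "P differentiable (at x)"
proof -
  have A: "(\<lambda>y. A y $ i $ j) differentiable (at x)" for i j
    using assms(3) bounded_linear.has_derivative[OF bounded_linear_matrix_entry]
    unfolding differentiable_def by blast
  have w: "(\<lambda>y. w y $ i) differentiable (at x)" for i
    using assms(4) bounded_linear.has_derivative[OF bounded_linear_vec_nth]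
    unfolding differentiable_def by blast
  let ?Q = "\<lambda>y. (\<Sum>k\<in>UNIV. (det (\<chi> i j. if j = k then w y $ i else A y $ i $ j) / det (A y)) *\<^sub>R axis k 1)"
  have "(\<lambda>y. (if j = k then w y $ i else A y $ i $ j)) differentiable (at x)" for i j k
    using A w by (cases "j = k") auto
  then have d: "(\<lambda>y. det (\<chi> i j. if j = k then w y $ i else A y $ i $ j)) differentiable (at x)" for k
    by (intro differentiable_det) simp
  have "?Q differentiable (at x)"
    using assms(6)[OF assms(2)]
    by (intro differentiable_sum differentiable_scaleR differentiable_divide differentiable_const
        d differentiable_det[OF A] ballI finite)
  moreover have "?Q y = P y" if "y \<in> S" for y
    using cramer[OF assms(6)[OF that], of "P y" "w y"] assms(5)[OF that]
    by (subst (2) basis_expansion[symmetric]) (simp add: scalar_mult_eq_scaleR)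
  ultimately show ?thesis
    using has_derivative_transform_within_open[OF _ assms(1,2)] unfolding differentiable_def by blast
qed

lemma mult_matrix_inv:
  fixes A :: "real^'n^'n"
  assumes "det A \<noteq> 0"
  shows "A *v (matrix_inv A *v w) = w"
proof -
  have "\<exists>A'. A ** A' = mat 1 \<and> A' ** A = mat 1"
    using assms invertible_det_nz[of A] unfolding invertible_def by blast
  from someI_ex[OF this] show ?thesis
    by (simp add: matrix_inv_def matrix_vector_mul_assoc)
qed

lemma matrix_vector_mult_cancel:
  fixes A :: "real^'n^'n"
  assumes "det A \<noteq> 0" "A *v u = A *v w"
  shows "u = w"
  using assms invertible_det_nz[of A] inj_matrix_vector_mult[of A] by (meson injD)


section \<open>The curvature tensor in coordinates\<close>

text \<open>A metric read in one chart. It may degenerate, since the points with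
  \<open>det (G x) = 0\<close> are the ones of interest.\<close>

locale coordinate_metric =
  fixes G :: "real^'m \<Rightarrow> real^'m^'m" and \<Omega> :: "(real^'m) set"
  assumes open_dom: "open \<Omega>" and smooth: "smooth_on \<Omega> G"
    and symmetric: "\<And>x. x \<in> \<Omega> \<Longrightarrow> transpose (G x) = G x"
begin

definition DG :: "real^'m \<Rightarrow> real^'m \<Rightarrow> real^'m^'m" where
  "DG x u = frechet_derivative G (at x) u"

text \<open>Christoffel symbols of the first kind, the lowered index being encoded as a vector for
  the Euclidean inner product. Raising the index would require the inverse of \<open>G\<close>,
  whereas these stay smooth where \<open>G\<close> degenerates.\<close>

definition christoffel :: "real^'m \<Rightarrow> real^'m \<Rightarrow> real^'m \<Rightarrow> real^'m" where
  "christoffel x u w = (1/2) *\<^sub>R (DG x u *v w + DG x w *v u - (\<Sum>b\<in>Basis. (u \<bullet> (DG x b *v w)) *\<^sub>R b))"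

definition Dchristoffel :: "real^'m \<Rightarrow> real^'m \<Rightarrow> real^'m \<Rightarrow> real^'m \<Rightarrow> real^'m" where
  "Dchristoffel x u y z = frechet_derivative (\<lambda>x. christoffel x y z) (at x) u"

text \<open>The number <R(X, Y)Z, W> in lowered Christoffel symbols. Its first two terms are smooth
  across degenerate points; any pole sits in the two terms with \<open>matrix_inv\<close>, which are
  meaningful where \<open>det (G x) \<noteq> 0\<close>.\<close>

definition riem :: "real^'m \<Rightarrow> real^'m \<Rightarrow> real^'m \<Rightarrow> real^'m \<Rightarrow> real^'m \<Rightarrow> real" where
  "riem x X Y Z W = W \<bullet> Dchristoffel x X Y Z - W \<bullet> Dchristoffel x Y X Z
     - christoffel x X W \<bullet> (matrix_inv (G x) *v christoffel x Y Z)
     + christoffel x Y W \<bullet> (matrix_inv (G x) *v christoffel x X Z)"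

lemma G_inner_commute: "x \<in> \<Omega> \<Longrightarrow> u \<bullet> (G x *v w) = w \<bullet> (G x *v u)"
  using inner_matrix_transpose symmetric by metis

lemma G_has_derivative: "x \<in> \<Omega> \<Longrightarrow> (G has_derivative DG x) (at x)"
  using smooth_on_has_derivative[OF smooth] unfolding DG_def .

lemma linear_DG: "x \<in> \<Omega> \<Longrightarrow> linear (DG x)"
  using G_has_derivative has_derivative_linear by blast

lemma DG_inner_commute:
  assumes "x \<in> \<Omega>"
  shows "u \<bullet> (DG x v *v w) = w \<bullet> (DG x v *v u)"
proof -
  have d: "((\<lambda>y. u \<bullet> (G y *v w)) has_derivative (\<lambda>v. u \<bullet> (DG x v *v w))) (at x)" for u w
    by (intro has_derivative_inner_right bounded_linear.has_derivative[OF
          bounded_bilinear.bounded_linear_left[OF bounded_bilinear_matrix_vector_mult]]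
        G_has_derivative assms)
  have "((\<lambda>y. u \<bullet> (G y *v w)) has_derivative (\<lambda>v. w \<bullet> (DG x v *v u))) (at x)"
    by (rule has_derivative_transform_within_open[OF d open_dom assms]) (rule G_inner_commute)
  from has_derivative_unique[OF d this] show ?thesis by metis
qed

lemma christoffel_inner:
  assumes "x \<in> \<Omega>"
  shows "christoffel x u w \<bullet> z
    = (w \<bullet> (DG x u *v z) + u \<bullet> (DG x w *v z) - u \<bullet> (DG x z *v w)) / 2"
proof -
  have "linear (\<lambda>z. u \<bullet> (DG x z *v w))"
    by (rule linearI) (simp_all add: linear_add[OF linear_DG[OF assms]] linear_cmul[OF linear_DG[OF assms]]
      matrix_vector_mult_add_rdistrib inner_add_right scaleR_matrix_vector_assoc[symmetric])
  from linear_sum_Basis[OF this, of z]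
  have "(\<Sum>b\<in>Basis. (u \<bullet> (DG x b *v w)) *\<^sub>R b) \<bullet> z = u \<bullet> (DG x z *v w)"
    by (simp add: inner_sum_left inner_commute[of z] mult.commute)
  then show ?thesis
    by (simp add: christoffel_def inner_add_left inner_diff_left DG_inner_commute[OF assms, of _ _ z]
        inner_commute[of "_ *v _" z])
qed

lemma christoffel_commute: "x \<in> \<Omega> \<Longrightarrow> christoffel x u w = christoffel x w u"
  by (rule iffD1[OF vector_eq_rdot, OF allI])
    (simp add: christoffel_inner DG_inner_commute[of x u _ w])

lemma linear_christoffel: "x \<in> \<Omega> \<Longrightarrow> linear (christoffel x u)"
  by (rule linearI; rule iffD1[OF vector_eq_rdot, OF allI])
   (simp_all add: christoffel_inner inner_add_left linear_add[OF linear_DG] linear_cmul[OF linear_DG]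
      matrix_vector_mult_add_rdistrib matrix_vector_right_distrib inner_add_right
      scaleR_matrix_vector_assoc[symmetric] matrix_vector_mult_scaleR field_simps)

lemma linear_christoffel_left: "x \<in> \<Omega> \<Longrightarrow> linear (\<lambda>u. christoffel x u w)"
  using linear_christoffel[of x w] by (simp add: christoffel_commute[of x _ w])

text \<open>The lowered form of \<nabla>g = 0 on constant fields; it later trades derivatives of
  \<open>G\<close> for Christoffel terms.\<close>

lemma metric_compatible:
  "x \<in> \<Omega> \<Longrightarrow> a \<bullet> (DG x u *v b) = christoffel x u a \<bullet> b + christoffel x u b \<bullet> a"
  by (simp add: christoffel_inner DG_inner_commute[of x b _ a] DG_inner_commute[of x u _ a]
      DG_inner_commute[of x u _ b] field_simps)

lemma smooth_christoffel: "smooth_on \<Omega> (\<lambda>x. christoffel x u w)"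
proof -
  have "Ck_on k \<Omega> (\<lambda>x. frechet_derivative G (at x) v)" for v k
    using smooth unfolding smooth_on_def by (metis Ck_on.simps(2))
  then have *: "Ck_on k \<Omega> (\<lambda>x. DG x v *v y)" for k v y
    unfolding DG_def
    by (rule Ck_on_linear_compose[OF open_dom bounded_bilinear.bounded_linear_left[OF
            bounded_bilinear_matrix_vector_mult]])
  show ?thesis
    unfolding smooth_on_def christoffel_def diff_conv_add_uminus sum_negf[symmetric]
    by (intro allI Ck_on_linear_compose[OF open_dom bounded_linear_scaleR_right]
        Ck_on_add[OF open_dom] Ck_on_sum[OF open_dom] *
        Ck_on_linear_compose[OF open_dom bounded_linear_minus[OF bounded_linear_ident]]
        Ck_on_linear_compose[OF open_dom bounded_linear_scaleR_left]
        Ck_on_linear_compose[OF open_dom bounded_linear_inner_right])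
qed

lemma christoffel_has_derivative:
  "x \<in> \<Omega> \<Longrightarrow> ((\<lambda>x. christoffel x y z) has_derivative (\<lambda>u. Dchristoffel x u y z)) (at x)"
  using smooth_on_has_derivative[OF smooth_christoffel] unfolding Dchristoffel_def .

lemma linear_Dchristoffel: "x \<in> \<Omega> \<Longrightarrow> linear (\<lambda>u. Dchristoffel x u y z)"
  using christoffel_has_derivative has_derivative_linear by blast

text \<open>Turns pointwise identities between Christoffel symbols into identities between their
  derivatives; symmetry and linearity are transported in this way.\<close>

lemma Dchristoffel_unique:
  assumes "x \<in> \<Omega>" "(f has_derivative f') (at x)" "\<And>y. y \<in> \<Omega> \<Longrightarrow> f y = christoffel y v z"
  shows "Dchristoffel x u v z = f' u"
  using has_derivative_unique[OF has_derivative_transform_within_open[OF assms(2) open_dom assms(1,3)]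
     christoffel_has_derivative[OF assms(1)]] by metis

lemma Dchristoffel_commute: "x \<in> \<Omega> \<Longrightarrow> Dchristoffel x u y z = Dchristoffel x u z y"
  using Dchristoffel_unique[OF _ christoffel_has_derivative] christoffel_commute by metis

lemma linear_Dchristoffel_right:
  assumes "x \<in> \<Omega>" shows "linear (Dchristoffel x u y)"
proof (rule linearI)
  show "Dchristoffel x u y (a + b) = Dchristoffel x u y a + Dchristoffel x u y b" for a b
    by (rule Dchristoffel_unique[OF assms has_derivative_add[OF christoffel_has_derivative
            christoffel_has_derivative]])
      (simp_all add: assms linear_add[OF linear_christoffel])
  show "Dchristoffel x u y (r *\<^sub>R a) = r *\<^sub>R Dchristoffel x u y a" for r a
    by (rule Dchristoffel_unique[OF assms has_derivative_scaleR_right[OF christoffel_has_derivative]])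
      (simp_all add: assms linear_cmul[OF linear_christoffel])
qed

lemma linear_Dchristoffel_middle: "x \<in> \<Omega> \<Longrightarrow> linear (\<lambda>y. Dchristoffel x u y z)"
  using linear_Dchristoffel_right[of x u z] by (simp add: Dchristoffel_commute[of x _ _ z])

section \<open>Symmetries of the curvature tensor and its second difference\<close>

lemma matrix_inv_inner_commute:
  assumes "x \<in> \<Omega>" "det (G x) \<noteq> 0"
  shows "u \<bullet> (matrix_inv (G x) *v w) = w \<bullet> (matrix_inv (G x) *v u)"
proof -
  have i: "G x *v (matrix_inv (G x) *v w) = w" for w
    by (rule mult_matrix_inv[OF assms(2)])
  have "u \<bullet> (matrix_inv (G x) *v w) = (G x *v (matrix_inv (G x) *v u)) \<bullet> (matrix_inv (G x) *v w)"
    by (simp add: i)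
  also have "\<dots> = (matrix_inv (G x) *v u) \<bullet> (G x *v (matrix_inv (G x) *v w))"
    by (metis G_inner_commute[OF assms(1)] inner_commute)
  finally show ?thesis by (simp add: i inner_commute)
qed

lemma riem_antisym_left: "riem x X Y Z W = - riem x Y X Z W"
  by (simp add: riem_def)

text \<open>Since \<open>2 * (Z \<bullet> christoffel y v Z)\<close> equals
  \<open>Z \<bullet> (DG y v *v Z)\<close>, the derivative terms of \<open>riem\<close> are mixed
  second derivatives of \<open>G\<close> and cancel. The other two terms cancel because the inverse
  matrix is symmetric.\<close>

lemma riem_alternating_right:
  assumes "x \<in> \<Omega>" "det (G x) \<noteq> 0"
  shows "riem x X Y Z Z = 0"
proof -
  have D: "2 * (Z \<bullet> Dchristoffel x u v Z) = Z \<bullet> (frechet_derivative (\<lambda>y. DG y v) (at x) u *v Z)" for u v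
  proof -
    have 1: "((\<lambda>y. 2 * (Z \<bullet> christoffel y v Z)) has_derivative (\<lambda>u. 2 * (Z \<bullet> Dchristoffel x u v Z))) (at x)"
      by (intro has_derivative_mult_right has_derivative_inner_right christoffel_has_derivative assms)
    have "((\<lambda>y. Z \<bullet> (DG y v *v Z)) has_derivative
        (\<lambda>u. Z \<bullet> (frechet_derivative (\<lambda>y. DG y v) (at x) u *v Z))) (at x)"
      unfolding DG_def
      by (intro has_derivative_inner_right bounded_linear.has_derivative[OF
          bounded_bilinear.bounded_linear_left[OF bounded_bilinear_matrix_vector_mult]]
          smooth_on_has_derivative[OF smooth_on_frechet_derivative[OF smooth]] assms)
    then have "((\<lambda>y. 2 * (Z \<bullet> christoffel y v Z)) has_derivative
        (\<lambda>u. Z \<bullet> (frechet_derivative (\<lambda>y. DG y v) (at x) u *v Z))) (at x)"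
      by (rule has_derivative_transform_within_open[OF _ open_dom assms(1)])
        (simp add: inner_commute[of Z "christoffel _ _ _"] christoffel_inner DG_inner_commute[of _ v _ Z])
    from has_derivative_unique[OF 1 this] show ?thesis by (rule fun_cong)
  qed
  have "frechet_derivative (\<lambda>y. DG y X) (at x) Y = frechet_derivative (\<lambda>y. DG y Y) (at x) X"
    unfolding DG_def by (rule symmetric_second_derivative[OF open_dom assms(1) smooth])
  with D[of X Y] D[of Y X] show ?thesis
    by (simp add: riem_def matrix_inv_inner_commute[OF assms, of "christoffel x X Z"])
qed

lemma linear_riem:
  assumes "x \<in> \<Omega>"
  shows "linear (\<lambda>X. riem x X Y Z W)" "linear (\<lambda>Y. riem x X Y Z W)"
    "linear (\<lambda>Z. riem x X Y Z W)" "linear (\<lambda>W. riem x X Y Z W)"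
  by (rule linearI; simp add: riem_def linear_add[OF linear_Dchristoffel[OF assms]]
      linear_cmul[OF linear_Dchristoffel[OF assms]] linear_add[OF linear_Dchristoffel_right[OF assms]]
      linear_cmul[OF linear_Dchristoffel_right[OF assms]]  linear_add[OF linear_Dchristoffel_middle[OF assms]]
      linear_cmul[OF linear_Dchristoffel_middle[OF assms]] linear_add[OF linear_christoffel[OF assms]]
      linear_cmul[OF linear_christoffel[OF assms]]  linear_add[OF linear_christoffel_left[OF assms]]
      linear_cmul[OF linear_christoffel_left[OF assms]]
      inner_add_left inner_add_right matrix_vector_right_distrib matrix_vector_mult_scaleR
      algebra_simps)+

lemma riem_alternating_left: "riem x X X Z W = 0"
  using riem_antisym_left[of x X X Z W] by simp

text \<open>An alternating form sees only the bivector of its arguments, here X \<and> Y + r Z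
  \<and> (a X + b Y). The term of order r^2 is a multiple of Z \<and> Z and drops out.\<close>

lemma alternating_wedge:
  fixes f :: "'v::real_vector \<Rightarrow> 'v \<Rightarrow> real"
  assumes "\<And>y. linear (\<lambda>x. f x y)" "\<And>x. linear (f x)" "\<And>x. f x x = 0"
  shows "f (X + (r * b) *\<^sub>R Z) (Y - (r * a) *\<^sub>R Z) = f X Y + r * f Z (a *\<^sub>R X + b *\<^sub>R Y)"
proof -
  have anti: "f x y = - f y x" for x y
    using assms(3)[of "x + y"] assms(3)[of x] assms(3)[of y]
    by (simp add: linear_add[OF assms(1)] linear_add[OF assms(2)])
  show ?thesis
    by (simp add: linear_add[OF assms(1)] linear_add[OF assms(2)] linear_diff[OF assms(2)]
        linear_cmul[OF assms(1)] linear_cmul[OF assms(2)] assms(3) anti[of X] algebra_simps)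
qed

text \<open>Using \<open>alternating_wedge\<close> in each of the two pairs of arguments makes
  \<open>N\<close> a quadratic polynomial in \<open>r\<close>. Its linear terms cancel between
  \<open>r\<close> and \<open>- r\<close>, and subtracting \<open>2 * N 0\<close> removes the
  constant one.\<close>

lemma riem_second_difference:
  fixes X Y Z :: "real^'m" and a b :: real
  assumes "x \<in> \<Omega>" "det (G x) \<noteq> 0"
  defines "N \<equiv> (\<lambda>r. riem x (X + (r * b) *\<^sub>R Z) (Y - (r * a) *\<^sub>R Z) (X + (r * b) *\<^sub>R Z) (Y - (r * a) *\<^sub>R Z))"
  defines "v \<equiv> a *\<^sub>R X + b *\<^sub>R Y"
  shows "N r + N (- r) - 2 * N 0 = 2 * r\<^sup>2 * riem x Z v Z v"
proof -
  have 1: "N r = riem x X Y X Y + r * riem x X Y Z v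
      + r * (riem x Z v X Y + r * riem x Z v Z v)" for r
  proof -
    have R: "riem x U V (X + (r * b) *\<^sub>R Z) (Y - (r * a) *\<^sub>R Z)
        = riem x U V X Y + r * riem x U V Z v" for U V
      unfolding v_def
      by (rule alternating_wedge) (intro linear_riem riem_alternating_right assms)+
    have "N r = riem x X Y (X + (r * b) *\<^sub>R Z) (Y - (r * a) *\<^sub>R Z)
        + r * riem x Z v (X + (r * b) *\<^sub>R Z) (Y - (r * a) *\<^sub>R Z)"
      unfolding v_def N_def
      by (rule alternating_wedge[of "\<lambda>U V. riem x U V _ _"]) (intro linear_riem riem_alternating_left assms)+
    then show ?thesis by (simp add: R)
  qed
  show ?thesis unfolding 1 by (simp add: power2_eq_square algebra_simps)
qed

text \<open>\<open>P\<close> stands for the covariant derivative of \<open>Z\<close> along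
  \<open>Y\<close>. The result is grouped for antisymmetrisation in X and Y: the first summand is
  symmetric, the second is so by symmetry of second derivatives, the third is the lowered covariant
  derivative of \<open>Z\<close> along the derivative of \<open>Y\<close> in direction
  \<open>X\<close>, and the last is half of \<open>riem\<close>, namely its terms of one sign
  pattern.\<close>

lemma second_covariant_derivative:
  fixes Y Z P :: "real^'m \<Rightarrow> real^'m"
  assumes V: "open V" "V \<subseteq> \<Omega>" "x \<in> V"
    and Y: "smooth_on V Y" and Z: "smooth_on V Z"
    and nz: "\<And>y. y \<in> V \<Longrightarrow> det (G y) \<noteq> 0"
    and P: "\<And>y. y \<in> V \<Longrightarrow>
        G y *v P y = G y *v frechet_derivative Z (at y) (Y y) + christoffel y (Y y) (Z y)"
  shows "P differentiable (at x)"
    and "W \<bullet> (G x *v frechet_derivative P (at x) X + christoffel x X (P x)) =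
        W \<bullet> (christoffel x X (frechet_derivative Z (at x) (Y x)) + christoffel x (Y x) (frechet_derivative Z (at x) X))
      + W \<bullet> (G x *v frechet_derivative (\<lambda>y. frechet_derivative Z (at y) (Y x)) (at x) X)
      + W \<bullet> (G x *v frechet_derivative Z (at x) (frechet_derivative Y (at x) X)
             + christoffel x (frechet_derivative Y (at x) X) (Z x))
      + (W \<bullet> Dchristoffel x X (Y x) (Z x) - christoffel x X W \<bullet> (matrix_inv (G x) *v christoffel x (Y x) (Z x)))"
proof -
  let ?DZ = "\<lambda>y. frechet_derivative Z (at y)" and ?DY = "frechet_derivative Y (at x)"
  let ?D2 = "\<lambda>v. frechet_derivative (\<lambda>y. ?DZ y v) (at x)"
  let ?w = "\<lambda>y. G y *v ?DZ y (Y y) + christoffel y (Y y) (Z y)"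
  have x: "x \<in> \<Omega>" using V by blast
  have dY: "(Y has_derivative ?DY) (at x)" and dZ: "(Z has_derivative ?DZ x) (at x)"
    using smooth_on_has_derivative Y Z V(3) by blast+
  have dDZ: "((\<lambda>y. ?DZ y (Y y)) has_derivative (\<lambda>h. ?D2 (Y x) h + ?DZ x (?DY h))) (at x)"
    by (rule has_derivative_family_apply[OF V(1,3) smooth_on_linear_frechet[OF Z]
          smooth_on_has_derivative[OF smooth_on_frechet_derivative[OF Z] V(3)] dY])
  have dc1: "((\<lambda>y. christoffel y (Y y) z) has_derivative
      (\<lambda>h. Dchristoffel x h (Y x) z + christoffel x (?DY h) z)) (at x)" for z
    by (rule has_derivative_family_apply[OF open_dom x linear_christoffel_left
          christoffel_has_derivative[OF x] dY])
  have dc: "((\<lambda>y. christoffel y (Y y) (Z y)) has_derivative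
      (\<lambda>h. Dchristoffel x h (Y x) (Z x) + christoffel x (?DY h) (Z x) + christoffel x (Y x) (?DZ x h))) (at x)"
    by (rule has_derivative_family_apply[OF open_dom x linear_christoffel dc1 dZ])
  have dw: "(?w has_derivative (\<lambda>h. (G x *v (?D2 (Y x) h + ?DZ x (?DY h)) + DG x h *v ?DZ x (Y x))
     + (Dchristoffel x h (Y x) (Z x) + christoffel x (?DY h) (Z x) + christoffel x (Y x) (?DZ x h)))) (at x)"
    by (intro has_derivative_add dc bounded_bilinear.FDERIV[OF bounded_bilinear_matrix_vector_mult
          G_has_derivative[OF x] dDZ])
  show dP: "P differentiable (at x)"
    by (rule differentiable_solution[OF V(1,3) differentiableI[OF G_has_derivative[OF x]]
          differentiableI[OF dw] P nz])
  let ?DP = "frechet_derivative P (at x)"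
  have "((\<lambda>y. G y *v P y) has_derivative (\<lambda>h. G x *v ?DP h + DG x h *v P x)) (at x)"
    by (rule bounded_bilinear.FDERIV[OF bounded_bilinear_matrix_vector_mult
          G_has_derivative[OF x] frechet_derivative_works[THEN iffD1, OF dP]])
  then have "(?w has_derivative (\<lambda>h. G x *v ?DP h + DG x h *v P x)) (at x)"
    by (rule has_derivative_transform_within_open[OF _ V(1,3) P])
  from fun_cong[OF has_derivative_unique[OF this dw], of X]
  have 1: "G x *v ?DP X = G x *v (?D2 (Y x) X + ?DZ x (?DY X)) + DG x X *v ?DZ x (Y x)
     + (Dchristoffel x X (Y x) (Z x) + christoffel x (?DY X) (Z x) + christoffel x (Y x) (?DZ x X)) - DG x X *v P x"
    by (simp add: algebra_simps)
  have "G x *v P x = G x *v (?DZ x (Y x) + matrix_inv (G x) *v christoffel x (Y x) (Z x))"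
    using P[OF V(3)] by (simp add: matrix_vector_right_distrib mult_matrix_inv[OF nz[OF V(3)]])
  from matrix_vector_mult_cancel[OF nz[OF V(3)] this]
  have 2: "christoffel x X W \<bullet> P x = christoffel x X W \<bullet> ?DZ x (Y x)
      + christoffel x X W \<bullet> (matrix_inv (G x) *v christoffel x (Y x) (Z x))"
    by (simp add: inner_add_right)
  \<comment> \<open>Used for the two terms with \<open>DG x X\<close> in 1. For
    \<open>u = P x\<close> the summand \<open>christoffel x X u \<bullet> W\<close> cancels against
    the left-hand side of the goal, and the other brings in the inverse matrix by 2.\<close>
  have 3: "W \<bullet> (DG x X *v u) = christoffel x X W \<bullet> u + christoffel x X u \<bullet> W" for u
    by (rule metric_compatible[OF x])
  show "W \<bullet> (G x *v ?DP X + christoffel x X (P x)) =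
        W \<bullet> (christoffel x X (?DZ x (Y x)) + christoffel x (Y x) (?DZ x X))
      + W \<bullet> (G x *v ?D2 (Y x) X)
      + W \<bullet> (G x *v ?DZ x (?DY X) + christoffel x (?DY X) (Z x))
      + (W \<bullet> Dchristoffel x X (Y x) (Z x) - christoffel x X W \<bullet> (matrix_inv (G x) *v christoffel x (Y x) (Z x)))"
    unfolding 1 by (simp add: 3 2 inner_add_right inner_diff_right matrix_vector_right_distrib
        inner_commute[of _ W])
qed

text \<open>\<open>q1\<close>, \<open>q2\<close>, \<open>q3\<close> are the three terms of the
  curvature. In the difference the first two groups of \<open>second_covariant_derivative\<close>
  cancel, the third is used up by the bracket \<open>B\<close>, and the last gives
  \<open>riem\<close>.\<close>

lemma curvature_eq_riem:
  fixes X Y Z P Q :: "real^'m \<Rightarrow> real^'m"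
  assumes V: "open V" "V \<subseteq> \<Omega>" "x \<in> V"
    and X: "smooth_on V X" and Y: "smooth_on V Y" and Z: "smooth_on V Z"
    and nz: "\<And>y. y \<in> V \<Longrightarrow> det (G y) \<noteq> 0"
    and P: "\<And>y. y \<in> V \<Longrightarrow>
        G y *v P y = G y *v frechet_derivative Z (at y) (Y y) + christoffel y (Y y) (Z y)"
    and Q: "\<And>y. y \<in> V \<Longrightarrow>
        G y *v Q y = G y *v frechet_derivative Z (at y) (X y) + christoffel y (X y) (Z y)"
    and q: "G x *v q1 = G x *v frechet_derivative P (at x) (X x) + christoffel x (X x) (P x)"
      "G x *v q2 = G x *v frechet_derivative Q (at x) (Y x) + christoffel x (Y x) (Q x)"
      "G x *v q3 = G x *v frechet_derivative Z (at x) B + christoffel x B (Z x)"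
    and B: "B = frechet_derivative Y (at x) (X x) - frechet_derivative X (at x) (Y x)"
  shows "W \<bullet> (G x *v (q1 - q2 - q3)) = riem x (X x) (Y x) (Z x) W"
proof -
  have x: "x \<in> \<Omega>" using V by blast
  have l: "linear (frechet_derivative Z (at x))"
    using smooth_on_linear_frechet[OF Z V(3)] .
  show ?thesis
    using second_covariant_derivative(2)[OF V Y Z nz P, of W "X x"]
      second_covariant_derivative(2)[OF V X Z nz Q, of W "Y x"]
    unfolding matrix_vector_mult_diff_distrib q
      symmetric_second_derivative[OF V(1,3) Z, of "Y x" "X x"] B
    by (simp add: riem_def linear_diff[OF l] linear_diff[OF linear_christoffel_left[OF x]]
        matrix_vector_mult_diff_distrib inner_add_right inner_diff_right)
qed

end


section \<open>The pole of the curvature tensor\<close>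

lemma tendsto_directional_quotient:
  assumes "(f has_derivative f') (at x)"
  shows "((\<lambda>t. (1 / t) *\<^sub>R (f (x + t *\<^sub>R z) - f x)) \<longlongrightarrow> f' z) (at 0)"
proof -
  have "((\<lambda>t. x + t *\<^sub>R z) has_derivative (\<lambda>t. t *\<^sub>R z)) (at 0)"
    by (auto intro!: derivative_eq_intros)
  from diff_chain_at[OF this, of f f'] assms
  have "((\<lambda>t. f (x + t *\<^sub>R z)) has_derivative (\<lambda>t. t *\<^sub>R f' z)) (at 0)"
    using linear_cmul[OF has_derivative_linear[OF assms]] by (simp add: o_def)
  then have *: "((\<lambda>t. norm (f (x + t *\<^sub>R z) - f x - t *\<^sub>R f' z) / norm t) \<longlongrightarrow> 0) (at 0)"
    unfolding has_derivative_iff_norm by simp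
  have "((\<lambda>t. norm ((1 / t) *\<^sub>R (f (x + t *\<^sub>R z) - f x) - f' z)) \<longlongrightarrow> 0) (at 0)"
  proof (rule Lim_transform_eventually[OF *])
    have "norm (f (x + t *\<^sub>R z) - f x - t *\<^sub>R f' z) / norm t
        = norm ((1 / t) *\<^sub>R (f (x + t *\<^sub>R z) - f x) - f' z)" if "t \<noteq> 0" for t
    proof -
      have "(1 / t) *\<^sub>R (f (x + t *\<^sub>R z) - f x) - f' z = (1 / t) *\<^sub>R (f (x + t *\<^sub>R z) - f x - t *\<^sub>R f' z)"
        using that by (simp add: scaleR_diff_right)
      then show ?thesis by simp
    qed
    then show "\<forall>\<^sub>F t in at 0. norm (f (x + t *\<^sub>R z) - f x - t *\<^sub>R f' z) / norm t
        = norm ((1 / t) *\<^sub>R (f (x + t *\<^sub>R z) - f x) - f' z)"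
      by (auto simp: eventually_at_filter)
  qed
  from Lim_null[THEN iffD2, OF tendsto_norm_zero_cancel[OF this]] show ?thesis .
qed

lemma tendsto_line: "((\<lambda>t. x + t *\<^sub>R z) \<longlongrightarrow> (x::'a::real_normed_vector)) (at (0::real))"
proof -
  have "((\<lambda>t. x + t *\<^sub>R z) \<longlongrightarrow> x + 0 *\<^sub>R z) (at (0::real))" by (intro tendsto_intros)
  then show ?thesis by simp
qed

lemma tendsto_det:
  fixes A :: "'t \<Rightarrow> real^'n^'n"
  assumes "\<And>i j. ((\<lambda>t. A t $ i $ j) \<longlongrightarrow> A0 $ i $ j) F"
  shows "((\<lambda>t. det (A t)) \<longlongrightarrow> det A0) F"
  unfolding det_def by (intro tendsto_intros assms)

lemma tendsto_matrix_vector_mult: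
  fixes A :: "'t \<Rightarrow> real^'n^'m"
  shows "(A \<longlongrightarrow> A0) F \<Longrightarrow> (v \<longlongrightarrow> v0) F \<Longrightarrow> ((\<lambda>t. A t *v v t) \<longlongrightarrow> A0 *v v0) F"
  by (rule bounded_bilinear.tendsto[OF bounded_bilinear_matrix_vector_mult])

context coordinate_metric
begin

abbreviation Ddet :: "real^'m \<Rightarrow> real^'m \<Rightarrow> real" where
  "Ddet x \<equiv> frechet_derivative (\<lambda>y. det (G y)) (at x)"

lemma det_has_derivative: "x \<in> \<Omega> \<Longrightarrow> ((\<lambda>y. det (G y)) has_derivative Ddet x) (at x)"
  by (rule smooth_on_has_derivative[of \<Omega>])
    (use smooth Ck_on_det[OF open_dom] in \<open>auto simp: smooth_on_def\<close>)

lemma tendsto_along_line: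
  assumes "x \<in> \<Omega>" "smooth_on \<Omega> f"
  shows "((\<lambda>t. f (x + t *\<^sub>R z)) \<longlongrightarrow> f x) (at 0)"
proof -
  have "isCont f x"
    using smooth_on_continuous[OF assms(2)] open_dom assms(1) continuous_on_eq_continuous_at by blast
  from isCont_tendsto_compose[OF this tendsto_line] show ?thesis .
qed

lemma eventually_line_in:
  "open V \<Longrightarrow> x \<in> V \<Longrightarrow> eventually (\<lambda>t::real. x + t *\<^sub>R z \<in> V) (at 0)"
  for x :: "real^'m"
  by (rule topological_tendstoD[OF tendsto_line])

lemma det_quotient:
  assumes "x \<in> \<Omega>" "det (G x) = 0"
  shows "((\<lambda>t. det (G (x + t *\<^sub>R z)) / t) \<longlongrightarrow> Ddet x z) (at 0)"
  using tendsto_directional_quotient[OF det_has_derivative[OF assms(1)], of z] assms(2) by simp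

lemma eventually_det_nonzero:
  assumes "x \<in> \<Omega>" "det (G x) = 0" "Ddet x z \<noteq> 0"
  shows "eventually (\<lambda>t. det (G (x + t *\<^sub>R z)) \<noteq> 0) (at 0)"
  using tendsto_imp_eventually_ne[OF det_quotient[OF assms(1,2)] assms(3)]
  by eventually_elim auto

section \<open>The radical direction at a first-order zero of the determinant\<close>

lemma kernel_quotient:
  assumes "x \<in> \<Omega>" "G x *v u = 0"
  shows "((\<lambda>t. (1 / t) *\<^sub>R (G (x + t *\<^sub>R z) *v u)) \<longlongrightarrow> DG x z *v u) (at 0)"
proof -
  have "((\<lambda>y. G y *v u) has_derivative (\<lambda>h. DG x h *v u)) (at x)"
    by (rule bounded_linear.has_derivative[OF bounded_bilinear.bounded_linear_left[OF
            bounded_bilinear_matrix_vector_mult] G_has_derivative[OF assms(1)]])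
  from tendsto_directional_quotient[OF this, of z] show ?thesis
    using assms(2) by simp
qed

(* Replacing row k of G(x + t z) by u^T G(x + t z) / t multiplies the determinant by u_k / t; let t tend
   to 0. *)
lemma det_kernel_row:
  assumes x: "x \<in> \<Omega>" "det (G x) = 0" and u: "G x *v u = 0"
  shows "det (\<chi> i. if i = k then DG x z *v u else row i (G x)) = u $ k * Ddet x z"
proof -
  let ?G = "\<lambda>t. G (x + t *\<^sub>R z)"
  let ?M = "\<lambda>t. \<chi> i. if i = k then (1 / t) *\<^sub>R (?G t *v u) else row i (?G t)"
  have "((\<lambda>t. det (?M t)) \<longlongrightarrow> det (\<chi> i. if i = k then DG x z *v u else row i (G x))) (at 0)"
  proof (rule tendsto_det)
    fix i j
    show "((\<lambda>t. ?M t $ i $ j) \<longlongrightarrow> (\<chi> i. if i = k then DG x z *v u else row i (G x)) $ i $ j) (at 0)"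
    proof (cases "i = k")
      case True
      then show ?thesis using tendsto_vec_nth[OF kernel_quotient[OF x(1) u], where i = j] by simp
    next
      case False
      then show ?thesis
        by (simp add: row_def tendsto_vec_nth tendsto_along_line[OF x(1) smooth])
    qed
  qed
  moreover have "eventually (\<lambda>t. det (?M t) = u $ k * (det (?G t) / t)) (at 0)"
    using eventually_line_in[OF open_dom x(1), of z]
  proof eventually_elim
    case (elim t)
    have 1: "?G t *v u = (\<Sum>i\<in>UNIV. u $ i *s row i (?G t))"
      using symmetric[OF elim] vector_matrix_mult_def matrix_mult_sum[of "?G t" u]
      by (metis (no_types, lifting) column_transpose sum.cong)
    have "det (?M t) = (1 / t) * det (\<chi> i. if i = k then ?G t *v u else row i (?G t))"
      by (simp only: scalar_mult_eq_scaleR[symmetric] det_row_mul)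
    then show ?case unfolding 1 cramer_lemma_transpose by simp
  qed
  then have "((\<lambda>t. det (?M t)) \<longlongrightarrow> u $ k * Ddet x z) (at 0)"
    using tendsto_cong tendsto_mult_left[OF det_quotient[OF x, of z], of "u $ k"] by fastforce
  ultimately show ?thesis using tendsto_unique[OF trivial_limit_at] by blast
qed

lemma kernel_row_mult:
  "(\<chi> i. if i = k then a else row i A) *v w = (\<chi> i. if i = k then a \<bullet> w else (A *v w) $ i)"
  for a w :: "real^'n"
  by (simp add: vec_eq_iff matrix_vector_mult_def inner_vec_def row_def)

text \<open>The matrix in \<open>det_kernel_row\<close> is invertible for a suitable
  \<open>k\<close>, and the assumptions on \<open>w\<close> say that it annihilates
  \<open>w\<close>. With w = u this yields (\<partial>_z g)(u, u) \<noteq> 0; subtracting a multiple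
  of \<open>u\<close> from a kernel vector then shows that the kernel is the line through
  \<open>u\<close>.\<close>

lemma kernel_nondegenerate:
  assumes x: "x \<in> \<Omega>" "det (G x) = 0" "Ddet x z \<noteq> 0"
    and u: "G x *v u = 0" "u \<noteq> 0" and w: "G x *v w = 0" "w \<bullet> (DG x z *v u) = 0"
  shows "w = 0"
proof -
  obtain k where k: "u $ k \<noteq> 0" using u(2) by (auto simp: vec_eq_iff)
  let ?M = "\<chi> i. if i = k then DG x z *v u else row i (G x)"
  have "det ?M \<noteq> 0" using det_kernel_row[OF x(1,2) u(1)] k x(3) by simp
  moreover have "?M *v w = ?M *v 0"
    unfolding kernel_row_mult using w by (simp add: vec_eq_iff inner_commute)
  ultimately show ?thesis by (rule matrix_vector_mult_cancel)
qed

text \<open>For this \<open>h\<close> the matrix in \<open>det_kernel_row\<close> is singular. A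
  nonzero vector in its kernel turns out to be a multiple of \<open>u\<close>, and the replaced row
  then says (\<partial>_h g)(u, u) = 0.\<close>

lemma kernel_isotropic:
  assumes x: "x \<in> \<Omega>" "det (G x) = 0" "Ddet x z \<noteq> 0"
    and u: "G x *v u = 0" "u \<noteq> 0" and h: "Ddet x h = 0"
  shows "u \<bullet> (DG x h *v u) = 0"
proof -
  obtain k where k: "u $ k \<noteq> 0" using u(2) by (auto simp: vec_eq_iff)
  let ?M = "\<chi> i. if i = k then DG x h *v u else row i (G x)"
  have "det ?M = 0" using det_kernel_row[OF x(1,2) u(1)] h by simp
  then obtain w where w: "w \<noteq> 0" "?M *v w = 0"
    using invertible_det_nz[of ?M] matrix_left_invertible_ker[of ?M] invertible_left_inverse[of ?M] by blast
  have w1: "(DG x h *v u) \<bullet> w = 0" and w2: "\<And>i. i \<noteq> k \<Longrightarrow> (G x *v w) $ i = 0"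
    using w(2) unfolding kernel_row_mult by (auto simp: vec_eq_iff split: if_splits)
  \<comment> \<open>Component \<open>k\<close> of \<open>G x *v w\<close> is not controlled by the
    replaced matrix. Pairing with \<open>u\<close> leaves only that component, with the nonzero
    factor \<open>u $ k\<close>.\<close>
  have "u \<bullet> (G x *v w) = 0" using G_inner_commute[OF x(1), of u w] u(1) by simp
  moreover have "u \<bullet> (G x *v w) = (\<Sum>i\<in>UNIV. if i = k then u $ k * (G x *v w) $ k else 0)"
    unfolding inner_vec_def by (rule sum.cong) (auto simp: w2)
  ultimately have "(G x *v w) $ k = 0" using k by simp
  with w2 have Gw: "G x *v w = 0" by (simp add: vec_eq_iff) metis
  have e: "u \<bullet> (DG x z *v u) \<noteq> 0"
    using kernel_nondegenerate[OF x u u(1)] u(2) by blast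
  \<comment> \<open>The multiple for which \<open>w - l *\<^sub>R u\<close> is orthogonal to
    \<open>DG x z *v u\<close>, as \<open>kernel_nondegenerate\<close> requires.\<close>
  define l where "l = w \<bullet> (DG x z *v u) / (u \<bullet> (DG x z *v u))"
  have "w - l *\<^sub>R u = 0"
    by (rule kernel_nondegenerate[OF x u])
      (use e in \<open>simp_all add: matrix_vector_mult_diff_distrib matrix_vector_mult_scaleR Gw u inner_diff_left l_def\<close>)
  then have "w = l *\<^sub>R u" by simp
  with w w1 show ?thesis by (auto simp: inner_commute)
qed

(* By Cramer's rule det(G) G^(-1) c has a limit. It lies in the kernel of G x, and pairing with u
   determines which multiple of u it is. *)
lemma scaled_inverse_limit:
  assumes x: "x \<in> \<Omega>" "det (G x) = 0" "Ddet x z \<noteq> 0"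
    and u: "G x *v u = 0" "u \<noteq> 0" and c: "(c \<longlongrightarrow> c0) (at 0)"
  shows "((\<lambda>t. det (G (x + t *\<^sub>R z)) *\<^sub>R (matrix_inv (G (x + t *\<^sub>R z)) *v c t))
     \<longlongrightarrow> (Ddet x z * (u \<bullet> c0) / (u \<bullet> (DG x z *v u))) *\<^sub>R u) (at 0)"
proof -
  let ?G = "\<lambda>t. G (x + t *\<^sub>R z)"
  let ?xi = "\<lambda>t. det (?G t) *\<^sub>R (matrix_inv (?G t) *v c t)"
  define xi0 where "xi0 = (\<chi> k. det (\<chi> i j. if j = k then c0 $ i else G x $ i $ j))"
  have Gt: "(?G \<longlongrightarrow> G x) (at 0)" by (rule tendsto_along_line[OF x(1) smooth])
  have nz: "eventually (\<lambda>t. det (?G t) \<noteq> 0) (at 0)" by (rule eventually_det_nonzero[OF x])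
  have lim: "(?xi \<longlongrightarrow> xi0) (at 0)"
  proof (rule vec_tendstoI)
    fix k
    have "((\<lambda>t. det (\<chi> i j. if j = k then c t $ i else ?G t $ i $ j)) \<longlongrightarrow> xi0 $ k) (at 0)"
      unfolding xi0_def vec_lambda_beta
    proof (rule tendsto_det)
      show "((\<lambda>t. (\<chi> i j. if j = k then c t $ i else ?G t $ i $ j) $ i $ j)
        \<longlongrightarrow> (\<chi> i j. if j = k then c0 $ i else G x $ i $ j) $ i $ j) (at 0)" for i j
        using tendsto_vec_nth[OF c, of i] tendsto_vec_nth[OF tendsto_vec_nth[OF Gt], of i j]
        by (cases "j = k") simp_all
    qed
    moreover have "eventually (\<lambda>t. det (\<chi> i j. if j = k then c t $ i else ?G t $ i $ j) = ?xi t $ k) (at 0)"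
      using nz
    proof eventually_elim
      case (elim t)
      from cramer[OF elim, THEN iffD1, OF mult_matrix_inv[OF elim, of "c t"]] elim
      show ?case by simp
    qed
    ultimately show "((\<lambda>t. ?xi t $ k) \<longlongrightarrow> xi0 $ k) (at 0)"
      by (rule Lim_transform_eventually)
  qed
  have Gxi: "eventually (\<lambda>t. ?G t *v ?xi t = det (?G t) *\<^sub>R c t) (at 0)"
    using nz by eventually_elim (simp add: matrix_vector_mult_scaleR mult_matrix_inv)
  have "((\<lambda>t. det (?G t)) \<longlongrightarrow> 0) (at 0)"
    using tendsto_det[OF tendsto_vec_nth[OF tendsto_vec_nth[OF Gt]]] x(2) by simp
  from tendsto_scaleR[OF this c]
  have "((\<lambda>t. ?G t *v ?xi t) \<longlongrightarrow> 0) (at 0)"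
    using Gxi tendsto_cong by force
  then have k0: "G x *v xi0 = 0"
    using tendsto_unique[OF trivial_limit_at tendsto_matrix_vector_mult[OF Gt lim]] by blast
  \<comment> \<open>Since \<open>G x *v u = 0\<close>, pairing the system with \<open>u\<close>
    gives only 0 = 0 in the limit. Dividing by \<open>t\<close> first retains the first-order part,
    which is the pairing with \<open>DG x z *v u\<close>.\<close>
  have "((\<lambda>t. (det (?G t) / t) * (u \<bullet> c t)) \<longlongrightarrow> Ddet x z * (u \<bullet> c0)) (at 0)"
    by (intro tendsto_intros det_quotient x c)
  moreover have "eventually (\<lambda>t. (det (?G t) / t) * (u \<bullet> c t) = ((1 / t) *\<^sub>R (?G t *v u)) \<bullet> ?xi t) (at 0)"
    using Gxi eventually_line_in[OF open_dom x(1), of z]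
  proof eventually_elim
    case (elim t)
    have "(?G t *v u) \<bullet> ?xi t = u \<bullet> (?G t *v ?xi t)"
      by (metis G_inner_commute[OF elim(2)] inner_commute)
    then show ?case unfolding inner_scaleR_left elim(1) by auto
  qed
  ultimately have "((\<lambda>t. ((1 / t) *\<^sub>R (?G t *v u)) \<bullet> ?xi t) \<longlongrightarrow> Ddet x z * (u \<bullet> c0)) (at 0)"
    by (rule Lim_transform_eventually)
  then have p: "(DG x z *v u) \<bullet> xi0 = Ddet x z * (u \<bullet> c0)"
    using tendsto_unique[OF trivial_limit_at tendsto_inner[OF kernel_quotient[OF x(1) u(1)] lim]] by blast
  have e: "u \<bullet> (DG x z *v u) \<noteq> 0"
    using kernel_nondegenerate[OF x u u(1)] u(2) by blast
  have "xi0 - (Ddet x z * (u \<bullet> c0) / (u \<bullet> (DG x z *v u))) *\<^sub>R u = 0"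
    by (rule kernel_nondegenerate[OF x u])
      (use e p in \<open>simp_all add: matrix_vector_mult_diff_distrib matrix_vector_mult_scaleR k0 u
        inner_diff_left inner_commute[of xi0]\<close>)
  then show ?thesis using lim by simp
qed

text \<open>The factor \<open>det\<close> kills the terms without inverse, and
  \<open>scaled_inverse_limit\<close> evaluates the two others. With e = (\<partial>_z g)(u, u), the
  vector \<open>christoffel x z u\<close>, which equals \<open>christoffel x u z\<close>, pairs with
  \<open>u\<close> to e / 2; it occurs twice, and division by e leaves \<open>- Ddet x z\<close>
  times e / 4. The vector \<open>v t\<close> varies because it will be a X + b Y along the
  line.\<close>

lemma riem_pole:
  assumes x: "x \<in> \<Omega>" "det (G x) = 0" "Ddet x z \<noteq> 0"
    and u: "G x *v u = 0" "u \<noteq> 0" "Ddet x u = 0" and v: "(v \<longlongrightarrow> u) (at 0)"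
  shows "((\<lambda>t. det (G (x + t *\<^sub>R z)) * riem (x + t *\<^sub>R z) z (v t) z (v t))
     \<longlongrightarrow> - Ddet x z * (u \<bullet> (DG x z *v u)) / 4) (at 0)"
proof -
  let ?x = "\<lambda>t. x + t *\<^sub>R z"
  have inD: "eventually (\<lambda>t. ?x t \<in> \<Omega>) (at 0)" by (rule eventually_line_in[OF open_dom x(1)])
  have c0: "((\<lambda>t. christoffel (?x t) a b) \<longlongrightarrow> christoffel x a b) (at 0)" for a b
    by (rule tendsto_along_line[OF x(1) smooth_christoffel])
  have c1: "((\<lambda>t. christoffel (?x t) a (v t)) \<longlongrightarrow> christoffel x a u) (at 0)" for a
    by (rule tendsto_family_apply[OF eventually_mono[OF inD] linear_christoffel[OF x(1)] c0 v])
      (rule linear_christoffel)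
  have c1': "((\<lambda>t. christoffel (?x t) (v t) a) \<longlongrightarrow> christoffel x u a) (at 0)" for a
    by (rule tendsto_family_apply[OF eventually_mono[OF inD] linear_christoffel_left[OF x(1)] c0 v])
      (rule linear_christoffel_left)
  have c2: "((\<lambda>t. christoffel (?x t) (v t) (v t)) \<longlongrightarrow> christoffel x u u) (at 0)"
    by (rule tendsto_family_apply[OF eventually_mono[OF inD] linear_christoffel[OF x(1)] c1' v])
      (rule linear_christoffel)
  have d0: "((\<lambda>t. Dchristoffel (?x t) a b c) \<longlongrightarrow> Dchristoffel x a b c) (at 0)" for a b c
    unfolding Dchristoffel_def
    by (rule tendsto_along_line[OF x(1) smooth_on_frechet_derivative[OF smooth_christoffel]])
  have d1: "((\<lambda>t. Dchristoffel (?x t) z (v t) z) \<longlongrightarrow> Dchristoffel x z u z) (at 0)"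
    by (rule tendsto_family_apply[OF eventually_mono[OF inD] linear_Dchristoffel_middle[OF x(1)] d0 v])
      (rule linear_Dchristoffel_middle)
  have d2: "((\<lambda>t. Dchristoffel (?x t) (v t) z z) \<longlongrightarrow> Dchristoffel x u z z) (at 0)"
    by (rule tendsto_family_apply[OF eventually_mono[OF inD] linear_Dchristoffel[OF x(1)] d0 v])
      (rule linear_Dchristoffel)
  have det0: "((\<lambda>t. det (G (?x t))) \<longlongrightarrow> 0) (at 0)"
    using tendsto_det[OF tendsto_vec_nth[OF tendsto_vec_nth[OF tendsto_along_line[OF x(1) smooth, of z]]]] x(2)
    by simp
  let ?e = "u \<bullet> (DG x z *v u)"
  have "((\<lambda>t. det (G (?x t)) * (v t \<bullet> Dchristoffel (?x t) z (v t) z - v t \<bullet> Dchristoffel (?x t) (v t) z z)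
     - christoffel (?x t) z (v t) \<bullet> (det (G (?x t)) *\<^sub>R (matrix_inv (G (?x t)) *v christoffel (?x t) (v t) z))
     + christoffel (?x t) (v t) (v t) \<bullet> (det (G (?x t)) *\<^sub>R (matrix_inv (G (?x t)) *v christoffel (?x t) z z)))
     \<longlongrightarrow> 0 * (u \<bullet> Dchristoffel x z u z - u \<bullet> Dchristoffel x u z z)
     - christoffel x z u \<bullet> ((Ddet x z * (u \<bullet> christoffel x u z) / ?e) *\<^sub>R u)
     + christoffel x u u \<bullet> ((Ddet x z * (u \<bullet> christoffel x z z) / ?e) *\<^sub>R u)) (at 0)"
    by (intro tendsto_intros det0 d1 d2 v c0 c1 c1' c2 scaled_inverse_limit x u)
  moreover have "christoffel x z u \<bullet> u = ?e / 2" "u \<bullet> christoffel x u z = ?e / 2"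
    using christoffel_inner[OF x(1), of z u u] DG_inner_commute[OF x(1), of z u u]
    by (simp_all add: inner_commute[of u "christoffel _ _ _"] christoffel_commute[OF x(1), of u z])
  moreover have "christoffel x u u \<bullet> u = 0"
    using christoffel_inner[OF x(1), of u u u] kernel_isotropic[OF x u] by simp
  moreover have "?e \<noteq> 0"
    using kernel_nondegenerate[OF x u(1,2,1)] u(2) by blast
  ultimately have "((\<lambda>t. det (G (?x t)) * (v t \<bullet> Dchristoffel (?x t) z (v t) z - v t \<bullet> Dchristoffel (?x t) (v t) z z)
     - christoffel (?x t) z (v t) \<bullet> (det (G (?x t)) *\<^sub>R (matrix_inv (G (?x t)) *v christoffel (?x t) (v t) z))
     + christoffel (?x t) (v t) (v t) \<bullet> (det (G (?x t)) *\<^sub>R (matrix_inv (G (?x t)) *v christoffel (?x t) z z)))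
     \<longlongrightarrow> - Ddet x z * ?e / 4) (at 0)"
    by simp
  then show ?thesis by (simp add: riem_def algebra_simps)
qed

section \<open>First-order behaviour of the Gram determinant and of the curvature quotient\<close>

definition gram_det :: "real^'m \<Rightarrow> real^'m \<Rightarrow> real^'m \<Rightarrow> real" where
  "gram_det x U W = (U \<bullet> (G x *v U)) * (W \<bullet> (G x *v W)) - (U \<bullet> (G x *v W)) * (W \<bullet> (G x *v U))"

text \<open>With v = a X + b Y one has (a^2 + b^2) det Gram(X, Y) = (<X, X> + <Y, Y>) <v, v> - <X,
  v>^2 - <Y, v>^2, which treats all pairs (a, b) alike. Since v is radical at \<open>x\<close>, the
  squares are of second order in t and only the first product contributes.\<close>

lemma gram_quotient:
  assumes x: "x \<in> \<Omega>"
    and X: "(X has_derivative X') (at x)" and Y: "(Y has_derivative Y') (at x)"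
    and u: "G x *v (a *\<^sub>R X x + b *\<^sub>R Y x) = 0" and ab: "(a, b) \<noteq> (0, 0)"
  defines "u \<equiv> a *\<^sub>R X x + b *\<^sub>R Y x"
  shows "((\<lambda>t. gram_det (x + t *\<^sub>R z) (X (x + t *\<^sub>R z)) (Y (x + t *\<^sub>R z)) / t)
    \<longlongrightarrow> (X x \<bullet> (G x *v X x) + Y x \<bullet> (G x *v Y x)) * (u \<bullet> (DG x z *v u)) / (a\<^sup>2 + b\<^sup>2)) (at 0)"
proof -
  let ?x = "\<lambda>t. x + t *\<^sub>R z"
  let ?G = "\<lambda>t. G (?x t)"
  define v where "v y = a *\<^sub>R X y + b *\<^sub>R Y y" for y
  let ?E = "\<lambda>t. gram_det (?x t) (X (?x t)) (Y (?x t))"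
  have cX: "((\<lambda>t. X (?x t)) \<longlongrightarrow> X x) (at 0)" and cY: "((\<lambda>t. Y (?x t)) \<longlongrightarrow> Y x) (at 0)"
    using isCont_tendsto_compose[OF has_derivative_continuous[OF X] tendsto_line]
      isCont_tendsto_compose[OF has_derivative_continuous[OF Y] tendsto_line] by auto
  have cv: "((\<lambda>t. v (?x t)) \<longlongrightarrow> u) (at 0)"
    unfolding v_def u_def by (intro tendsto_intros cX cY)
  have cG: "(?G \<longlongrightarrow> G x) (at 0)" by (rule tendsto_along_line[OF x(1) smooth])
  define p where "p = G x *v (a *\<^sub>R X' z + b *\<^sub>R Y' z) + DG x z *v u"
  have "((\<lambda>y. G y *v v y) has_derivative (\<lambda>h. G x *v (a *\<^sub>R X' h + b *\<^sub>R Y' h) + DG x h *v v x)) (at x)"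
    unfolding v_def
    by (intro bounded_bilinear.FDERIV[OF bounded_bilinear_matrix_vector_mult G_has_derivative[OF x]]
        has_derivative_add has_derivative_scaleR_right X Y)
  from tendsto_directional_quotient[OF this, of z]
  have q: "((\<lambda>t. (1 / t) *\<^sub>R (?G t *v v (?x t))) \<longlongrightarrow> p) (at 0)"
    using u by (simp add: v_def u_def p_def)
  \<comment> \<open>\<open>u\<close> is orthogonal to the image of \<open>G x\<close>, so the
    derivatives of \<open>X\<close> and \<open>Y\<close> disappear and the limit depends only on
    their values at \<open>x\<close>.\<close>
  have up: "u \<bullet> p = u \<bullet> (DG x z *v u)"
    using G_inner_commute[OF x, of u] u by (simp add: p_def inner_add_right u_def[symmetric])
  have r: "((\<lambda>t. X (?x t) \<bullet> (?G t *v v (?x t))) \<longlongrightarrow> 0) (at 0)"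
    "((\<lambda>t. Y (?x t) \<bullet> (?G t *v v (?x t))) \<longlongrightarrow> 0) (at 0)"
    using tendsto_inner[OF cX tendsto_matrix_vector_mult[OF cG cv]]
      tendsto_inner[OF cY tendsto_matrix_vector_mult[OF cG cv]] u by (simp_all add: u_def)
  have "((\<lambda>t. (X (?x t) \<bullet> (?G t *v X (?x t)) + Y (?x t) \<bullet> (?G t *v Y (?x t))) * (v (?x t) \<bullet> ((1 / t) *\<^sub>R (?G t *v v (?x t))))
      - (X (?x t) \<bullet> (?G t *v v (?x t))) * (X (?x t) \<bullet> ((1 / t) *\<^sub>R (?G t *v v (?x t))))
      - (Y (?x t) \<bullet> (?G t *v v (?x t))) * (Y (?x t) \<bullet> ((1 / t) *\<^sub>R (?G t *v v (?x t)))))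
    \<longlongrightarrow> (X x \<bullet> (G x *v X x) + Y x \<bullet> (G x *v Y x)) * (u \<bullet> p) - 0 * (X x \<bullet> p) - 0 * (Y x \<bullet> p)) (at 0)"
    by (intro tendsto_diff tendsto_mult tendsto_add tendsto_inner tendsto_matrix_vector_mult cX cY cG cv q r)
  moreover have "eventually (\<lambda>t. (X (?x t) \<bullet> (?G t *v X (?x t)) + Y (?x t) \<bullet> (?G t *v Y (?x t))) * (v (?x t) \<bullet> ((1 / t) *\<^sub>R (?G t *v v (?x t))))
      - (X (?x t) \<bullet> (?G t *v v (?x t))) * (X (?x t) \<bullet> ((1 / t) *\<^sub>R (?G t *v v (?x t))))
      - (Y (?x t) \<bullet> (?G t *v v (?x t))) * (Y (?x t) \<bullet> ((1 / t) *\<^sub>R (?G t *v v (?x t))))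
      = (a\<^sup>2 + b\<^sup>2) * (?E t / t)) (at 0)"
    using eventually_line_in[OF open_dom x, of z]
  proof eventually_elim
    case (elim t)
    show ?case unfolding gram_det_def v_def
      by (simp add: matrix_vector_right_distrib matrix_vector_mult_scaleR inner_add_left inner_add_right
          G_inner_commute[OF elim, of "Y _" "X _"] power2_eq_square diff_divide_distrib[symmetric]
          add_divide_distrib[symmetric])
        (simp add: algebra_simps)
  qed
  ultimately have "((\<lambda>t. (a\<^sup>2 + b\<^sup>2) * (?E t / t))
    \<longlongrightarrow> (X x \<bullet> (G x *v X x) + Y x \<bullet> (G x *v Y x)) * (u \<bullet> (DG x z *v u))) (at 0)"
    using Lim_transform_eventually up by fastforce
  from tendsto_divide[OF this tendsto_const[of "a\<^sup>2 + b\<^sup>2"]] show ?thesis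
    using ab by (simp add: sum_power2_eq_zero_iff)
qed

(* The perturbation turns the bivector X \<and> Y into X \<and> Y + s det(G) z \<and> v with v = a X + b Y, so the second
   difference in s of the numerators is 2 det(G)^2 riem(z, v, z, v). It is only of first order along
   the line because of the pole of riem, whereas equal limits of the quotients would make it o(t). *)
lemma curvature_quotients_differ:
  fixes X Y :: "real^'m \<Rightarrow> real^'m" and Xs Ys :: "real \<Rightarrow> real^'m \<Rightarrow> real^'m"
    and K :: "real \<Rightarrow> real \<Rightarrow> real"
  assumes x: "x \<in> \<Omega>" "det (G x) = 0" "Ddet x z \<noteq> 0"
    and X: "X differentiable (at x)" and Y: "Y differentiable (at x)"
    and ab: "(a, b) \<noteq> (0, 0)"
    and u: "G x *v u = 0" "u \<noteq> 0" "Ddet x u = 0" "u = a *\<^sub>R X x + b *\<^sub>R Y x"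
    and trace: "X x \<bullet> (G x *v X x) + Y x \<bullet> (G x *v Y x) \<noteq> 0"
    and Xs_def: "\<And>s. Xs s = (\<lambda>y. X y + (s * det (G y) * b) *\<^sub>R z)"
    and Ys_def: "\<And>s. Ys s = (\<lambda>y. Y y - (s * det (G y) * a) *\<^sub>R z)"
    and K: "\<And>s. (K s \<longlongrightarrow> k) (at 0)"
    and KE: "\<And>s. eventually (\<lambda>t. gram_det (x + t *\<^sub>R z) (Xs s (x + t *\<^sub>R z)) (Ys s (x + t *\<^sub>R z)) \<noteq> 0 \<longrightarrow>
        K s t = riem (x + t *\<^sub>R z) (Xs s (x + t *\<^sub>R z)) (Ys s (x + t *\<^sub>R z)) (Xs s (x + t *\<^sub>R z)) (Ys s (x + t *\<^sub>R z))
          / gram_det (x + t *\<^sub>R z) (Xs s (x + t *\<^sub>R z)) (Ys s (x + t *\<^sub>R z))) (at 0)"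
  shows False
proof -
  let ?x = "\<lambda>t. x + t *\<^sub>R z"
  let ?e = "u \<bullet> (DG x z *v u)"
  let ?v = "\<lambda>y. a *\<^sub>R X y + b *\<^sub>R Y y"
  define d where "d = (X x \<bullet> (G x *v X x) + Y x \<bullet> (G x *v Y x)) * ?e / (a\<^sup>2 + b\<^sup>2)"
  define N where "N s t = riem (?x t) (Xs s (?x t)) (Ys s (?x t)) (Xs s (?x t)) (Ys s (?x t))" for s t
  have e: "?e \<noteq> 0"
    using kernel_nondegenerate[OF x u(1,2,1)] u(2) by blast
  have d: "d \<noteq> 0" unfolding d_def using e trace ab by (simp add: sum_power2_eq_zero_iff)
  obtain X' Y' where X': "(X has_derivative X') (at x)" and Y': "(Y has_derivative Y') (at x)"
    using X Y unfolding differentiable_def by blast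
  have Nlim: "((\<lambda>t. N s t / t) \<longlongrightarrow> k * d) (at 0)" for s
  proof -
    have Xs: "(Xs s has_derivative (\<lambda>h. X' h + (s * Ddet x h * b) *\<^sub>R z)) (at x)"
      unfolding Xs_def
      by (intro has_derivative_add X' has_derivative_scaleR_left has_derivative_mult_left
          has_derivative_mult_right det_has_derivative x)
    have Ys: "(Ys s has_derivative (\<lambda>h. Y' h - (s * Ddet x h * a) *\<^sub>R z)) (at x)"
      unfolding Ys_def
      by (intro has_derivative_diff Y' has_derivative_scaleR_left has_derivative_mult_left
          has_derivative_mult_right det_has_derivative x)
    \<comment> \<open>The factor \<open>det (G y)\<close> vanishes at \<open>x\<close>; hence the
      limit given by \<open>gram_quotient\<close> is the same \<open>d\<close> for every
      \<open>s\<close>.\<close>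
    have 0: "Xs s x = X x" "Ys s x = Y x" by (simp_all add: Xs_def Ys_def x)
    let ?E = "\<lambda>t. gram_det (?x t) (Xs s (?x t)) (Ys s (?x t))"
    have q: "((\<lambda>t. ?E t / t) \<longlongrightarrow> d) (at 0)"
      using gram_quotient[OF x(1) Xs Ys _ ab, of z] u
      unfolding d_def 0 by simp
    have "eventually (\<lambda>t. ?E t \<noteq> 0) (at 0)"
      using tendsto_imp_eventually_ne[OF q d] by eventually_elim auto
    then have "eventually (\<lambda>t. K s t * (?E t / t) = N s t / t) (at 0)"
      using KE[of s] by eventually_elim (simp add: N_def)
    from Lim_transform_eventually[OF tendsto_mult[OF K q] this] show ?thesis .
  qed
  have "((\<lambda>t. N 1 t / t + N (-1) t / t - 2 * (N 0 t / t)) \<longlongrightarrow> k * d + k * d - 2 * (k * d)) (at 0)"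
    by (intro tendsto_intros Nlim)
  moreover have "eventually (\<lambda>t. N 1 t / t + N (-1) t / t - 2 * (N 0 t / t)
      = 2 * (det (G (?x t)) / t) * (det (G (?x t)) * riem (?x t) z (?v (?x t)) z (?v (?x t)))) (at 0)"
    using eventually_det_nonzero[OF x] eventually_line_in[OF open_dom x(1), of z]
  proof eventually_elim
    case (elim t)
    have "N 1 t + N (- 1) t - 2 * N 0 t = 2 * (det (G (?x t)))\<^sup>2 * riem (?x t) z (?v (?x t)) z (?v (?x t))"
      using riem_second_difference[OF elim(2,1), of "X (?x t)" "det (G (?x t))" b z "Y (?x t)" a]
      by (simp add: N_def Xs_def Ys_def)
    from arg_cong[OF this, of "\<lambda>r. r / t"] show ?case
      by (simp add: power2_eq_square add_divide_distrib diff_divide_distrib mult.assoc)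
  qed
  ultimately have "((\<lambda>t. 2 * (det (G (?x t)) / t) * (det (G (?x t)) * riem (?x t) z (?v (?x t)) z (?v (?x t)))) \<longlongrightarrow> 0) (at 0)"
    using Lim_transform_eventually by fastforce
  moreover have "((\<lambda>t. ?v (?x t)) \<longlongrightarrow> u) (at 0)"
    unfolding u(4)
    by (intro tendsto_intros isCont_tendsto_compose[OF has_derivative_continuous[OF X'] tendsto_line]
        isCont_tendsto_compose[OF has_derivative_continuous[OF Y'] tendsto_line])
  then have "((\<lambda>t. 2 * (det (G (?x t)) / t) * (det (G (?x t)) * riem (?x t) z (?v (?x t)) z (?v (?x t))))
      \<longlongrightarrow> 2 * Ddet x z * (- Ddet x z * ?e / 4)) (at 0)"
    by (intro tendsto_mult tendsto_const det_quotient riem_pole x u(1-3))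
  ultimately have "2 * Ddet x z * (- Ddet x z * ?e / 4) = 0"
    using tendsto_unique[OF trivial_limit_at] by blast
  with x(3) e show False by simp
qed

end

lemma rank_square_iff_det:
  fixes A :: "real^'n^'n"
  shows "rank A = CARD('n) \<longleftrightarrow> det A \<noteq> 0"
  using full_rank_injective[of A] det_nz_iff_inj[of "(*v) A"]
  by (simp add: matrix_of_matrix_vector_mul)

section \<open>Fields in a chart\<close>

lemma chart_inverse:
  assumes "is_chart c"
  shows "q \<in> cdom c \<Longrightarrow> cinv c (cmap c q) = q"
    and "x \<in> cmap c ` cdom c \<Longrightarrow> cmap c (cinv c x) = x"
    and "x \<in> cmap c ` cdom c \<Longrightarrow> cinv c x \<in> cdom c"
  using assms unfolding is_chart_def homeomorphism_def by auto

lemma open_chart_image: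
  assumes "is_chart c" "open V"
  shows "open (cmap c ` (cdom c \<inter> V))"
proof -
  have "openin (top_of_set (cmap c ` cdom c)) (cmap c ` (cdom c \<inter> V))"
    by (rule homeomorphism_imp_open_map[of "cdom c" _ _ "cinv c"])
      (use assms in \<open>auto simp: is_chart_def openin_open_Int\<close>)
  then show ?thesis
    using assms(1) openin_open_trans unfolding is_chart_def by blast
qed

lemma smooth_structureD:
  assumes "smooth_structure \<Phi>" "c \<in> \<Phi>"
  shows "is_chart c" "d \<in> \<Phi> \<Longrightarrow> smooth_on (cmap c ` (cdom c \<inter> cdom d)) (transition c d)"
  using assms unfolding smooth_structure_def smooth_compatible_def by blast+

lemma open_chart_overlap:
  assumes "smooth_structure \<Phi>" "c \<in> \<Phi>" "d \<in> \<Phi>"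
  shows "open (cmap c ` (cdom c \<inter> cdom d))"
  using assms by (intro open_chart_image smooth_structureD) (auto simp: smooth_structure_def is_chart_def)

lemma coordinate_metric_chart:
  assumes "smooth_structure \<Phi>" "symmetric_tensor_field \<Phi> g" "c \<in> \<Phi>"
  shows "coordinate_metric (\<lambda>x. g c (cinv c x)) (cmap c ` cdom c)"
proof
  show "open (cmap c ` cdom c)"
    using assms unfolding smooth_structure_def is_chart_def by blast
  show "smooth_on (cmap c ` cdom c) (\<lambda>x. g c (cinv c x))"
    using assms unfolding symmetric_tensor_field_def o_def by blast
  show "transpose (g c (cinv c x)) = g c (cinv c x)" if "x \<in> cmap c ` cdom c" for x
    using assms that chart_inverse(3)[of c x] smooth_structureD(1)[OF assms(1,3)]
    unfolding symmetric_tensor_field_def charts_at_def by blast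
qed

lemma det_metric_transform:
  assumes "symmetric_tensor_field \<Phi> g" "c \<in> charts_at \<Phi> p" "d \<in> charts_at \<Phi> p"
    and "det (g d p) = 0"
  shows "det (g c p) = 0"
  using assms unfolding symmetric_tensor_field_def Let_def by (metis det_mul mult_zero_left mult_zero_right)

text \<open>\<open>singular_set\<close> asks for one chart of deficient rank. By the transformation
  law the determinant then vanishes in every chart around the point.\<close>

lemma singular_set_iff_det:
  assumes "symmetric_tensor_field \<Phi> g" "c \<in> \<Phi>" "p \<in> cdom c"
  shows "p \<in> singular_set \<Phi> g \<longleftrightarrow> det (g c p) = 0"
proof -
  have c: "c \<in> charts_at \<Phi> p" using assms by (simp add: charts_at_def)
  then have "p \<in> manifold_carrier \<Phi>" by (auto simp: charts_at_def manifold_carrier_def)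
  then show ?thesis
    using c det_metric_transform[OF assms(1) c] unfolding singular_set_def rank_square_iff_det by auto
qed

lemma vector_field_on_subset:
  "vector_field_on \<Phi> V X \<Longrightarrow> W \<subseteq> V \<Longrightarrow> vector_field_on \<Phi> W X"
  unfolding vector_field_on_def
  by (meson Int_mono image_mono smooth_on_subset subset_iff subset_refl)

section \<open>Vector fields that perturb an extension\<close>

lemma vector_field_on_add_scaleR:
  assumes s: "smooth_structure \<Phi>" and V: "open V"
    and X: "vector_field_on \<Phi> V X" and Z: "vector_field_on \<Phi> V Z"
    and f: "smooth_function_on \<Phi> V f"
  shows "vector_field_on \<Phi> V (\<lambda>c q. X c q + f q *\<^sub>R Z c q)"
  unfolding vector_field_on_def
proof (intro conjI ballI)
  fix c assume c: "c \<in> \<Phi>"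
  have o: "open (cmap c ` (cdom c \<inter> V))"
    using open_chart_image smooth_structureD(1)[OF s c] V by blast
  show "smooth_on (cmap c ` (cdom c \<inter> V)) ((\<lambda>q. X c q + f q *\<^sub>R Z c q) \<circ> cinv c)"
    using X Z f c unfolding vector_field_on_def smooth_function_on_def smooth_on_def o_def
    by (auto intro!: Ck_on_add[OF o] Ck_on_bilinear[OF o bounded_bilinear_scaleR])
next
  fix p c d assume p: "p \<in> V" and c: "c \<in> charts_at \<Phi> p" and d: "d \<in> charts_at \<Phi> p"
  have "linear (frechet_derivative (transition c d) (at (cmap c p)))"
    by (rule smooth_on_linear_frechet[OF smooth_structureD(2)[OF s]])
      (use c d in \<open>auto simp: charts_at_def\<close>)
  moreover have "X d p = frechet_derivative (transition c d) (at (cmap c p)) (X c p)"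
    "Z d p = frechet_derivative (transition c d) (at (cmap c p)) (Z c p)"
    using X Z p c d unfolding vector_field_on_def by blast+
  ultimately show "X d p + f p *\<^sub>R Z d p
      = frechet_derivative (transition c d) (at (cmap c p)) (X c p + f p *\<^sub>R Z c p)"
    by (simp only: linear_add linear_cmul)
qed

text \<open>The field with constant components \<open>z\<close> in the chart \<open>c\<close>. A
  field has to be given in every chart, whence the Jacobian of the transition.\<close>

definition coordinate_field :: "('a, 'm::finite) chart \<Rightarrow> real^'m \<Rightarrow> ('a, 'm) vfield" where
  "coordinate_field c z d q = frechet_derivative (transition c d) (at (cmap c q)) z"

lemma transition_smooth_inverse:
  assumes "smooth_structure \<Phi>" "c \<in> \<Phi>" "d \<in> \<Phi>" "y \<in> cmap d ` (cdom d \<inter> cdom c)"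
  shows "transition d c y \<in> cmap c ` (cdom c \<inter> cdom d)" "cinv c (transition d c y) = cinv d y"
    "cmap c (cinv d y) = transition d c y" "cinv d y \<in> cdom c" "cinv d y \<in> cdom d"
  using assms chart_inverse[OF smooth_structureD(1)[OF assms(1,2)]]
    chart_inverse[OF smooth_structureD(1)[OF assms(1,3)]]
  unfolding transition_def by auto

lemma smooth_in_overlap:
  assumes s: "smooth_structure \<Phi>" "c \<in> \<Phi>" "d \<in> \<Phi>"
    and f: "smooth_on (cmap c ` (cdom c \<inter> cdom d)) f"
  shows "smooth_on (cmap d ` (cdom d \<inter> cdom c)) (\<lambda>y. f (transition d c y))"
proof -
  have "transition d c ` cmap d ` (cdom d \<inter> cdom c) \<subseteq> cmap c ` (cdom c \<inter> cdom d)"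
    using transition_smooth_inverse(1)[OF s] by blast
  with f smooth_structureD(2)[OF s(1,3,2)] show ?thesis
    unfolding smooth_on_def using Ck_on_compose[OF open_chart_overlap[OF s(1,3,2)]] by blast
qed

text \<open>Smoothness in a chart \<open>d\<close> is that of the Jacobian of
  \<open>transition c d\<close>, precomposed with the reverse transition. The transformation law is
  the chain rule for a transition that factors through a third chart.\<close>

lemma vector_field_coordinate_field:
  assumes s: "smooth_structure \<Phi>" "c \<in> \<Phi>" and V: "V \<subseteq> cdom c" "open V"
  shows "vector_field_on \<Phi> V (coordinate_field c z)"
  unfolding vector_field_on_def
proof (intro conjI ballI)
  fix d assume d: "d \<in> \<Phi>"
  have "smooth_on (cmap d ` (cdom d \<inter> cdom c)) (\<lambda>y. frechet_derivative (transition c d) (at (transition d c y)) z)"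
    by (rule smooth_in_overlap[OF s d smooth_on_frechet_derivative[OF smooth_structureD(2)[OF s d]]])
  then have "smooth_on (cmap d ` (cdom d \<inter> cdom c)) (coordinate_field c z d \<circ> cinv d)"
    by (rule smooth_on_cong[OF open_chart_overlap[OF s(1) d s(2)]])
      (simp add: coordinate_field_def transition_smooth_inverse[OF s d])
  then show "smooth_on (cmap d ` (cdom d \<inter> V)) (coordinate_field c z d \<circ> cinv d)"
    by (rule smooth_on_subset) (use V in auto)
next
  fix p d e assume p: "p \<in> V" and d: "d \<in> charts_at \<Phi> p" and e: "e \<in> charts_at \<Phi> p"
  have d': "d \<in> \<Phi>" "p \<in> cdom d" and e': "e \<in> \<Phi>" "p \<in> cdom e" and c: "p \<in> cdom c"
    using d e p V by (auto simp: charts_at_def)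
  let ?x = "cmap c p"
  have inv: "cinv c ?x = p" using chart_inverse(1) smooth_structureD(1) s c by blast
  have y: "transition c d ?x = cmap d p" by (simp add: transition_def inv)
  have D1: "(transition c d has_derivative frechet_derivative (transition c d) (at ?x)) (at ?x)"
    by (rule smooth_on_has_derivative[OF smooth_structureD(2)[OF s d'(1)]]) (use c d' in blast)
  have D2: "(transition d e has_derivative frechet_derivative (transition d e) (at (cmap d p))) (at (cmap d p))"
    by (rule smooth_on_has_derivative[OF smooth_structureD(2)[OF s(1) d'(1) e'(1)]]) (use d' e' in blast)
  have D: "((transition d e \<circ> transition c d) has_derivative
      (\<lambda>v. frechet_derivative (transition d e) (at (cmap d p)) (frechet_derivative (transition c d) (at ?x) v))) (at ?x)"
    using diff_chain_at[OF D1] D2 unfolding y by (simp add: o_def)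
  have "(transition c e has_derivative
      (\<lambda>v. frechet_derivative (transition d e) (at (cmap d p)) (frechet_derivative (transition c d) (at ?x) v))) (at ?x)"
  proof (rule has_derivative_transform_within_open[OF D open_chart_overlap[OF s d'(1)]])
    show "?x \<in> cmap c ` (cdom c \<inter> cdom d)" using c d' by blast
    show "(transition d e \<circ> transition c d) x = transition c e x"
      if "x \<in> cmap c ` (cdom c \<inter> cdom d)" for x
      using that transition_smooth_inverse(2)[OF s(1) d'(1) s(2) that] by (simp add: transition_def)
  qed
  from frechet_derivative_at[OF this]
  show "coordinate_field c z e p
      = frechet_derivative (transition d e) (at (cmap d p)) (coordinate_field c z d p)"
    unfolding coordinate_field_def by metis
qed

lemma coordinate_field_self:
  assumes "smooth_structure \<Phi>" "c \<in> \<Phi>" "q \<in> cdom c"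
  shows "coordinate_field c z c q = z"
proof -
  have "((\<lambda>x. x) has_derivative (\<lambda>v. v)) (at (cmap c q))" by (rule has_derivative_ident)
  then have "(transition c c has_derivative (\<lambda>v. v)) (at (cmap c q))"
    by (rule has_derivative_transform_within_open[OF _ open_chart_overlap[OF assms(1,2,2)]])
      (use assms(3) chart_inverse(2)[OF smooth_structureD(1)[OF assms(1,2)]] in \<open>auto simp: transition_def\<close>)
  from frechet_derivative_at[OF this] show ?thesis
    unfolding coordinate_field_def by metis
qed

text \<open>The determinant of the components depends on the chart, but with \<open>c\<close> fixed
  it is an ordinary function on \<open>cdom c\<close>.\<close>

lemma smooth_function_det_metric:
  assumes s: "smooth_structure \<Phi>" "symmetric_tensor_field \<Phi> g" "c \<in> \<Phi>" and V: "V \<subseteq> cdom c"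
  shows "smooth_function_on \<Phi> V (\<lambda>q. r * det (g c q) * r')"
  unfolding smooth_function_on_def
proof
  fix d assume d: "d \<in> \<Phi>"
  let ?S = "cmap c ` (cdom c \<inter> cdom d)"
  have o: "open ?S" by (rule open_chart_overlap[OF s(1,3) d])
  have "smooth_on ?S (\<lambda>x. g c (cinv c x))"
    using coordinate_metric.smooth[OF coordinate_metric_chart[OF s]] by (rule smooth_on_subset) auto
  then have "smooth_on ?S (\<lambda>x. r * det (g c (cinv c x)) * r')"
    unfolding smooth_on_def
    by (auto intro!: Ck_on_bilinear[OF o bounded_bilinear_mult] Ck_on_const[OF o] Ck_on_det[OF o])
  from smooth_in_overlap[OF s(1,3) d this]
  have "smooth_on (cmap d ` (cdom d \<inter> cdom c)) ((\<lambda>q. r * det (g c q) * r') \<circ> cinv d)"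
    by (rule smooth_on_cong[OF open_chart_overlap[OF s(1) d s(3)]])
      (simp add: transition_smooth_inverse(2)[OF s(1,3) d])
  then show "smooth_on (cmap d ` (cdom d \<inter> V)) ((\<lambda>q. r * det (g c q) * r') \<circ> cinv d)"
    by (rule smooth_on_subset) (use V in auto)
qed


section \<open>The Levi-Civita connection in a chart\<close>

context
  fixes c :: "('a::topological_space, 'm::finite) chart" and g :: "('a, 'm) tensor2"
  assumes chart: "is_chart c"
    and coord: "coordinate_metric (\<lambda>x. g c (cinv c x)) (cmap c ` cdom c)"
begin

interpretation coordinate_metric "\<lambda>x. g c (cinv c x)" "cmap c ` cdom c"
  by (rule coord)

lemma dir_deriv_metric:
  assumes q: "q \<in> cdom c"
    and Y: "((Y c \<circ> cinv c) has_derivative Y') (at (cmap c q))"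
    and Z: "((Z c \<circ> cinv c) has_derivative Z') (at (cmap c q))"
  shows "dir_deriv c X (metric g Y Z c) q = Y c q \<bullet> (g c q *v Z' (X c q))
      + Y c q \<bullet> (DG (cmap c q) (X c q) *v Z c q) + Y' (X c q) \<bullet> (g c q *v Z c q)"
proof -
  have x: "cmap c q \<in> cmap c ` cdom c" using q by blast
  have e: "metric g Y Z c \<circ> cinv c
      = (\<lambda>x. (Y c \<circ> cinv c) x \<bullet> (g c (cinv c x) *v (Z c \<circ> cinv c) x))"
    by (rule ext) (simp add: metric_def)
  have "((metric g Y Z c \<circ> cinv c) has_derivative (\<lambda>h.
      (Y c \<circ> cinv c) (cmap c q) \<bullet> (g c (cinv c (cmap c q)) *v Z' h + DG (cmap c q) h *v (Z c \<circ> cinv c) (cmap c q))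
      + Y' h \<bullet> (g c (cinv c (cmap c q)) *v (Z c \<circ> cinv c) (cmap c q)))) (at (cmap c q))"
    unfolding e
    by (rule has_derivative_inner[OF Y bounded_bilinear.FDERIV[OF bounded_bilinear_matrix_vector_mult
            G_has_derivative[OF x] Z]])
  from frechet_derivative_at[OF this, symmetric] show ?thesis
    by (simp add: dir_deriv_def chart_inverse(1)[OF chart q] inner_add_right)
qed

text \<open>As \<open>w\<close> is constant, its brackets with \<open>X\<close> and \<open>Y\<close>
  cancel the terms in which these fields are differentiated along \<open>w\<close>. The bracket of
  \<open>X\<close> and \<open>Y\<close> cancels the derivative of \<open>X\<close> along
  \<open>Y\<close> and doubles that of \<open>Y\<close> along \<open>X\<close>.\<close>

lemma dual_connection_coordinates:
  assumes q: "q \<in> cdom c"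
    and X: "(X c \<circ> cinv c) differentiable (at (cmap c q))"
    and Y: "(Y c \<circ> cinv c) differentiable (at (cmap c q))"
  shows "dual_connection g X Y (\<lambda>_ _. w) c q
    = w \<bullet> (g c q *v frechet_derivative (Y c \<circ> cinv c) (at (cmap c q)) (X c q)
        + christoffel (cmap c q) (X c q) (Y c q))"
proof -
  let ?x = "cmap c q"
  let ?X' = "frechet_derivative (X c \<circ> cinv c) (at ?x)" and ?Y' = "frechet_derivative (Y c \<circ> cinv c) (at ?x)"
  have x: "?x \<in> cmap c ` cdom c" using q by blast
  note dX = frechet_derivative_works[THEN iffD1, OF X] and dY = frechet_derivative_works[THEN iffD1, OF Y]
  have dW: "(((\<lambda>_ _. w) c \<circ> cinv c) has_derivative (\<lambda>_. 0)) (at ?x)" by (simp add: o_def)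
  have bracket: "lie_bracket X Y c q = ?Y' (X c q) - ?X' (Y c q)"
    "lie_bracket Y (\<lambda>_ _. w) c q = - ?Y' w" "lie_bracket (\<lambda>_ _. w) X c q = ?X' w"
    by (simp_all add: lie_bracket_def dir_deriv_def o_def)
  have m: "g c q = g c (cinv c ?x)" by (simp add: chart_inverse(1)[OF chart q])
  note sym = G_inner_commute[OF x, folded m]
  show ?thesis
    unfolding dual_connection_def
      dir_deriv_metric[where Y = Y and Z = "\<lambda>_ _. w", OF q dY dW]
      dir_deriv_metric[where Y = "\<lambda>_ _. w" and Z = X, OF q dW dX]
      dir_deriv_metric[where Y = X and Z = Y, OF q dX dY] metric_def bracket inner_add_right
      inner_commute[of w "christoffel _ _ _"] christoffel_inner[OF x]
    by (simp add: inner_diff_left inner_add_left matrix_vector_mult_diff_distrib inner_diff_right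
        sym[of _ w] sym[of "X c q" "?Y' w"] DG_inner_commute[OF x, of w _ "X c q"])
qed

text \<open>Nondegeneracy gives the description in \<open>levi_civita\<close> exactly one solution.
  Lowered by the metric, the equation has the form that \<open>second_covariant_derivative\<close>
  expects.\<close>

lemma levi_civita_coordinates:
  assumes q: "q \<in> cdom c" "det (g c q) \<noteq> 0"
    and X: "(X c \<circ> cinv c) differentiable (at (cmap c q))"
    and Y: "(Y c \<circ> cinv c) differentiable (at (cmap c q))"
  shows "g c q *v levi_civita g X Y c q
    = g c q *v frechet_derivative (Y c \<circ> cinv c) (at (cmap c q)) (X c q)
        + christoffel (cmap c q) (X c q) (Y c q)" (is "_ = ?r")
proof -
  have x: "cmap c q \<in> cmap c ` cdom c" using q by blast
  have sym: "v \<bullet> (g c q *v w) = w \<bullet> (g c q *v v)" for v w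
    using G_inner_commute[OF x] by (simp add: chart_inverse(1)[OF chart q(1)])
  have "(\<forall>w. v \<bullet> (g c q *v w) = dual_connection g X Y (\<lambda>_ _. w) c q) \<longleftrightarrow> g c q *v v = ?r" for v
    unfolding dual_connection_coordinates[where X = X and Y = Y, OF q(1) X Y] sym[of v] vector_eq_ldot ..
  then have "levi_civita g X Y c q = (THE v. g c q *v v = ?r)"
    unfolding levi_civita_def by simp
  also have "\<dots> = matrix_inv (g c q) *v ?r"
    by (rule the_equality) (use mult_matrix_inv[OF q(2)] matrix_vector_mult_cancel[OF q(2)] in auto)
  finally show ?thesis by (simp add: mult_matrix_inv[OF q(2)])
qed

lemma metric_curvature_coordinates:
  assumes V: "open V" "V \<subseteq> cdom c" "q \<in> V" "det (g c q) \<noteq> 0"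
    and X: "smooth_on (cmap c ` V) (X c \<circ> cinv c)"
    and Y: "smooth_on (cmap c ` V) (Y c \<circ> cinv c)"
    and Z: "smooth_on (cmap c ` V) (Z c \<circ> cinv c)"
  shows "metric g (curvature g X Y Z) W c q = riem (cmap c q) (X c q) (Y c q) (Z c q) (W c q)"
proof -
  let ?G = "\<lambda>x. g c (cinv c x)"
  \<comment> \<open>The inner covariant derivatives satisfy their equations only where the metric is
    nondegenerate, and differentiating them requires an open set of such points.\<close>
  define O1 where "O1 = cmap c ` V \<inter> {x. det (?G x) \<noteq> 0}"
  have q: "q \<in> cdom c" using V by blast
  have x: "cmap c q \<in> cmap c ` cdom c" using q by blast
  have inv: "cinv c (cmap c q) = q" by (rule chart_inverse(1)[OF chart q])
  have oV: "open (cmap c ` V)"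
    using open_chart_image[OF chart V(1)] V(2) by (simp add: Int_absorb1)
  have "continuous_on (cmap c ` V) (\<lambda>x. det (?G x))"
    by (rule continuous_on_subset[OF has_derivative_continuous_on[OF
            has_derivative_at_withinI[OF det_has_derivative]]]) (use V(2) in auto)
  from continuous_open_preimage[OF this oV, of "- {0}"]
  have oO: "open O1" by (simp add: O1_def vimage_def open_Compl)
  have xO: "cmap c q \<in> O1" using V inv by (auto simp: O1_def)
  have sub: "O1 \<subseteq> cmap c ` V" "O1 \<subseteq> cmap c ` cdom c" using V by (auto simp: O1_def)
  note sm = smooth_on_subset[OF X sub(1)] smooth_on_subset[OF Y sub(1)] smooth_on_subset[OF Z sub(1)]
  have diff: "f differentiable (at x)" if "smooth_on O1 f" "x \<in> O1" for f :: "real^'m \<Rightarrow> real^'m" and x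
    using smooth_on_has_derivative[OF that] differentiableI by blast
  have nz: "det (?G x) \<noteq> 0" if "x \<in> O1" for x using that by (simp add: O1_def)
  have at: "cinv c y \<in> cdom c" "cmap c (cinv c y) = y" if "y \<in> O1" for y
    using chart_inverse(2,3)[OF chart] that sub by blast+
  have L: "?G y *v (levi_civita g X1 Z c \<circ> cinv c) y
      = ?G y *v frechet_derivative (Z c \<circ> cinv c) (at y) ((X1 c \<circ> cinv c) y)
        + christoffel y ((X1 c \<circ> cinv c) y) ((Z c \<circ> cinv c) y)"
    if "smooth_on O1 (X1 c \<circ> cinv c)" "y \<in> O1" for X1 y
    using levi_civita_coordinates[OF at(1)[OF that(2)] nz[OF that(2)], of X1 Z]
      diff[OF that] diff[OF sm(3) that(2)] by (simp add: at(2)[OF that(2)])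
  note P = L[where ?X1.0 = Y, OF sm(2)] and Q = L[where ?X1.0 = X, OF sm(1)]
  let ?B = "lie_bracket X Y"
  have B: "?B c q = frechet_derivative (Y c \<circ> cinv c) (at (cmap c q)) ((X c \<circ> cinv c) (cmap c q))
      - frechet_derivative (X c \<circ> cinv c) (at (cmap c q)) ((Y c \<circ> cinv c) (cmap c q))"
    by (simp add: lie_bracket_def dir_deriv_def inv)
  \<comment> \<open>This makes the bracket differentiable, as \<open>levi_civita_coordinates\<close>
    demands of the field along which it differentiates.\<close>
  have dd: "(\<lambda>x. frechet_derivative f (at x) (h x)) differentiable (at (cmap c q))"
    if f: "smooth_on O1 f" and h: "smooth_on O1 h" for f h :: "real^'m \<Rightarrow> real^'m"
    by (rule differentiableI[OF has_derivative_family_apply[OF oO xO smooth_on_linear_frechet[OF f]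
            smooth_on_has_derivative[OF smooth_on_frechet_derivative[OF f] xO] smooth_on_has_derivative[OF h xO]]])
  have "(\<lambda>x. frechet_derivative (Y c \<circ> cinv c) (at x) ((X c \<circ> cinv c) x)
      - frechet_derivative (X c \<circ> cinv c) (at x) ((Y c \<circ> cinv c) x)) differentiable (at (cmap c q))"
    by (intro differentiable_diff dd sm)
  then obtain B' where "((\<lambda>x. frechet_derivative (Y c \<circ> cinv c) (at x) ((X c \<circ> cinv c) x)
      - frechet_derivative (X c \<circ> cinv c) (at x) ((Y c \<circ> cinv c) x)) has_derivative B') (at (cmap c q))"
    unfolding differentiable_def by blast
  then have "((?B c \<circ> cinv c) has_derivative B') (at (cmap c q))"
    by (rule has_derivative_transform_within_open[OF _ oO xO]) (simp add: lie_bracket_def dir_deriv_def at)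
  then have dB: "(?B c \<circ> cinv c) differentiable (at (cmap c q))" by (rule differentiableI)
  note dP = second_covariant_derivative(1)[OF oO sub(2) xO sm(2,3) nz P]
    and dQ = second_covariant_derivative(1)[OF oO sub(2) xO sm(1,3) nz Q]
  have "W c q \<bullet> (?G (cmap c q) *v (levi_civita g X (levi_civita g Y Z) c q
      - levi_civita g Y (levi_civita g X Z) c q - levi_civita g ?B Z c q))
    = riem (cmap c q) ((X c \<circ> cinv c) (cmap c q)) ((Y c \<circ> cinv c) (cmap c q)) ((Z c \<circ> cinv c) (cmap c q)) (W c q)"
    by (rule curvature_eq_riem[OF oO sub(2) xO sm nz P Q _ _ _ B])
      (use levi_civita_coordinates[where X = X and Y = "levi_civita g Y Z", OF q V(4) diff[OF sm(1) xO] dP]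
        levi_civita_coordinates[where X = Y and Y = "levi_civita g X Z", OF q V(4) diff[OF sm(2) xO] dQ]
        levi_civita_coordinates[where X = "?B" and Y = Z, OF q V(4) dB diff[OF sm(3) xO]] in \<open>simp_all add: inv o_def\<close>)
  moreover have "metric g (curvature g X Y Z) W c q = W c q \<bullet> (g c q *v curvature g X Y Z c q)"
    using G_inner_commute[OF x] by (simp add: metric_def inv)
  ultimately show ?thesis by (simp add: inv curvature_def)
qed

end

section \<open>The degenerate plane\<close>

lemma quadratic_nonneg_linear_zero:
  fixes a b :: real
  assumes "\<And>s. 0 \<le> s * a + s\<^sup>2 * b"
  shows "a = 0"
proof (rule ccontr)
  assume "a \<noteq> 0"
  \<comment> \<open>A positive upper bound of \<open>b\<close>; the \<open>s\<close> chosen next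
    minimises \<open>s * a + s\<^sup>2 * d\<close>.\<close>
  define d where "d = \<bar>b\<bar> + 1"
  define s where "s = - a / (2 * d)"
  have d: "d > 0" "b \<le> d" by (simp_all add: d_def)
  have "s * a + s\<^sup>2 * b \<le> s * a + s\<^sup>2 * d"
    using d by (intro add_left_mono mult_left_mono) auto
  also have "\<dots> = - (a\<^sup>2 / (4 * d))"
    using d by (simp add: s_def power2_eq_square field_simps)
  also have "\<dots> < 0" using \<open>a \<noteq> 0\<close> d by simp
  finally show False using assms[of s] by linarith
qed

text \<open>The form at u + s w is a nonnegative polynomial in s without constant term, so its
  linear coefficient vanishes for every w.\<close>

lemma semidefinite_kernel:
  fixes A :: "real^'n^'n"
  assumes "transpose A = A" "\<And>v. 0 \<le> v \<bullet> (A *v v)" "u \<bullet> (A *v u) = 0"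
  shows "A *v u = 0"
proof -
  have "2 * (w \<bullet> (A *v u)) = 0" for w
  proof (rule quadratic_nonneg_linear_zero)
    fix s
    have "u \<bullet> (A *v w) = w \<bullet> (A *v u)" using inner_matrix_transpose[of u A w] assms(1) by simp
    then show "0 \<le> s * (2 * (w \<bullet> (A *v u))) + s\<^sup>2 * (w \<bullet> (A *v w))"
      using assms(2)[of "u + s *\<^sub>R w"] assms(3)
      by (simp add: matrix_vector_right_distrib matrix_vector_mult_scaleR inner_add_left
          inner_add_right power2_eq_square algebra_simps)
  qed
  from this[of "A *v u"] show ?thesis by simp
qed

lemma dim_span_pair_independent:
  fixes A B :: "'v::euclidean_space"
  assumes "dim (span {A, B}) = 2" "a *\<^sub>R A + b *\<^sub>R B = 0"
  shows "a = 0" "b = 0"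
proof -
  have *: "b = 0" if "dim (span {A, B}) = 2" "a *\<^sub>R A + b *\<^sub>R B = 0" for a b and A B :: 'v
  proof (rule ccontr)
    assume "b \<noteq> 0"
    have "b *\<^sub>R B = (- a) *\<^sub>R A" using that(2) by (simp add: add_eq_0_iff2 add.commute)
    then have "B = (- a / b) *\<^sub>R A" using \<open>b \<noteq> 0\<close>
      by (metis divide_inverse_commute inverse_eq_divide scaleR_one scaleR_scaleR left_inverse)
    then have "B \<in> span {A}" by (metis span_base span_scale singletonI)
    then have "dim {A, B} \<le> card {A}"
      by (intro dim_le_card) (auto intro: span_base)
    with that(1) show False by simp
  qed
  from *[OF assms] show "b = 0" .
  from *[of B A b a] assms show "a = 0" by (simp add: insert_commute add.commute)
qed

lemma rank_one_gram_kernel: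
  fixes A B :: "real^'n" and G :: "real^'n^'n"
  assumes sym: "transpose G = G" and psd: "\<And>v. 0 \<le> v \<bullet> (G *v v)"
    and r: "rank (vector [vector [A \<bullet> (G *v A), A \<bullet> (G *v B)],
      vector [B \<bullet> (G *v A), B \<bullet> (G *v B)]] :: real^2^2) = 1"
  obtains a b where "(a, b) \<noteq> (0, 0)" "G *v (a *\<^sub>R A + b *\<^sub>R B) = 0"
    and "A \<bullet> (G *v A) + B \<bullet> (G *v B) \<noteq> 0"
proof -
  let ?E = "vector [vector [A \<bullet> (G *v A), A \<bullet> (G *v B)],
      vector [B \<bullet> (G *v A), B \<bullet> (G *v B)]] :: real^2^2"
  define \<alpha> \<beta> \<gamma> where "\<alpha> = A \<bullet> (G *v A)" and "\<beta> = A \<bullet> (G *v B)" and "\<gamma> = B \<bullet> (G *v B)"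
  have \<beta>: "B \<bullet> (G *v A) = \<beta>" using inner_matrix_transpose[of B G A] sym by (simp add: \<beta>_def)
  have "det ?E = 0" using rank_square_iff_det[of ?E] r by simp
  then have d: "\<alpha> * \<gamma> = \<beta>\<^sup>2"
    by (simp add: det_2 \<beta> \<alpha>_def[symmetric] \<beta>_def[symmetric] \<gamma>_def[symmetric] power2_eq_square)
  \<comment> \<open>If both diagonal entries vanished, \<open>d\<close> would force \<beta> = 0 and
    the Gram matrix would have rank 0.\<close>
  have nz: "\<not> (\<alpha> = 0 \<and> \<gamma> = 0)"
  proof
    assume "\<alpha> = 0 \<and> \<gamma> = 0"
    then have "?E = 0" using d
      by (simp add: vec_eq_iff forall_2 \<beta> \<alpha>_def[symmetric] \<beta>_def[symmetric] \<gamma>_def[symmetric])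
    with r show False by simp
  qed
  have nn: "\<alpha> \<ge> 0" "\<gamma> \<ge> 0" using psd by (simp_all add: \<alpha>_def \<gamma>_def)
  \<comment> \<open>For \<alpha> \<noteq> 0 the pair (- \<beta>, \<alpha>) annihilates the first row
    of the Gram matrix; for \<alpha> = 0 the vector \<open>A\<close> is itself isotropic.\<close>
  define a b where "a = (if \<alpha> = 0 then 1 else - \<beta>)" and "b = (if \<alpha> = 0 then 0 else \<alpha>)"
  have ab: "(a, b) \<noteq> (0, 0)" by (simp add: a_def b_def)
  have "(a *\<^sub>R A + b *\<^sub>R B) \<bullet> (G *v (a *\<^sub>R A + b *\<^sub>R B)) = a\<^sup>2 * \<alpha> + 2 * a * b * \<beta> + b\<^sup>2 * \<gamma>"
    by (simp add: matrix_vector_right_distrib matrix_vector_mult_scaleR inner_add_left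
          inner_add_right power2_eq_square algebra_simps \<beta> \<alpha>_def[symmetric] \<beta>_def[symmetric] \<gamma>_def[symmetric])
  also have "\<dots> = 0"
  proof (cases "\<alpha> = 0")
    case False
    then have "a\<^sup>2 * \<alpha> + 2 * a * b * \<beta> + b\<^sup>2 * \<gamma> = \<alpha> * (\<alpha> * \<gamma> - \<beta>\<^sup>2)"
      by (simp add: a_def b_def power2_eq_square algebra_simps)
    then show ?thesis by (simp add: d)
  qed (simp add: a_def b_def)
  finally have "G *v (a *\<^sub>R A + b *\<^sub>R B) = 0" by (rule semidefinite_kernel[OF sym psd])
  moreover have "\<alpha> + \<gamma> \<noteq> 0" using nz nn by linarith
  ultimately show ?thesis using that ab by (simp add: \<alpha>_def \<gamma>_def)
qed

section \<open>The metric at points of the singular hypersurface\<close>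

lemma continuous_on_chart:
  assumes "smooth_structure \<Phi>" "symmetric_tensor_field \<Phi> g" "c \<in> \<Phi>"
  shows "continuous_on (cdom c) (g c)"
proof -
  have c: "is_chart c" by (rule smooth_structureD(1)[OF assms(1,3)])
  have "continuous_on (cdom c) (cmap c)" using c unfolding is_chart_def homeomorphism_def by blast
  moreover have "continuous_on (cmap c ` cdom c) (\<lambda>x. g c (cinv c x))"
    by (rule smooth_on_continuous[OF coordinate_metric.smooth[OF coordinate_metric_chart[OF assms]]])
  ultimately have "continuous_on (cdom c) (\<lambda>q. g c (cinv c (cmap c q)))"
    using continuous_on_compose2 by blast
  then show ?thesis
    by (rule continuous_on_cong[THEN iffD1, rotated -1]) (auto simp: chart_inverse(1)[OF c])
qed

lemma closure_riemannian_semidefinite: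
  assumes s: "smooth_structure \<Phi>" "symmetric_tensor_field \<Phi> g" "c \<in> \<Phi>"
    and p: "p \<in> cdom c" "p \<in> closure {q \<in> M. riemannian_at \<Phi> g q}"
  shows "0 \<le> v \<bullet> (g c p *v v)"
proof (rule ccontr)
  assume n: "\<not> 0 \<le> v \<bullet> (g c p *v v)"
  have o: "open (cdom c)" using smooth_structureD(1)[OF s(1,3)] by (simp add: is_chart_def)
  have "continuous_on (cdom c) (\<lambda>q. v \<bullet> (g c q *v v))"
    by (intro continuous_on_inner continuous_on_const
        bounded_bilinear.continuous_on[OF bounded_bilinear_matrix_vector_mult] continuous_on_chart[OF s])
  from continuous_open_preimage[OF this o, of "{..<0}"]
  have T: "open (cdom c \<inter> (\<lambda>q. v \<bullet> (g c q *v v)) -` {..<0})" (is "open ?T") by simp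
  have "p \<in> ?T" using p(1) n by simp
  with p(2) have "?T \<inter> {q \<in> M. riemannian_at \<Phi> g q} \<noteq> {}"
    using open_Int_closure_eq_empty[OF T] by blast
  then obtain q where q: "q \<in> cdom c" "v \<bullet> (g c q *v v) < 0" "riemannian_at \<Phi> g q"
    by auto
  from q(3) have "v \<noteq> 0 \<longrightarrow> 0 < v \<bullet> (g c q *v v)"
    using s(3) q(1) unfolding riemannian_at_def charts_at_def by blast
  with q(2) show False by auto
qed

text \<open>The determinant vanishes along every curve in the singular set. This turns geometric
  tangency of the radical into the condition \<open>Ddet x u = 0\<close> of
  \<open>riem_pole\<close>.\<close>

lemma tangent_det_derivative:
  assumes s: "smooth_structure \<Phi>" "symmetric_tensor_field \<Phi> g" "c \<in> \<Phi>"
    and u: "u \<in> tangent_space (singular_set \<Phi> g) c p"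
  shows "frechet_derivative (\<lambda>x. det (g c (cinv c x))) (at (cmap c p)) u = 0"
proof -
  interpret coordinate_metric "\<lambda>x. g c (cinv c x)" "cmap c ` cdom c"
    by (rule coordinate_metric_chart[OF s])
  obtain \<gamma> e where e: "e > 0" "\<gamma> 0 = p" "\<forall>t\<in>{-e<..<e}. \<gamma> t \<in> singular_set \<Phi> g \<inter> cdom c"
    and d: "((cmap c \<circ> \<gamma>) has_vector_derivative u) (at (0::real))"
    using u unfolding tangent_space_def by blast
  have "0 \<in> {-e<..<e}" using e(1) by simp
  then have p: "cmap c p \<in> cmap c ` cdom c" using e by blast
  have "((\<lambda>x. det (g c (cinv c x))) \<circ> (cmap c \<circ> \<gamma>) has_derivative (\<lambda>r. Ddet (cmap c p) (r *\<^sub>R u))) (at 0)"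
    using diff_chain_at[OF d[unfolded has_vector_derivative_def], of "\<lambda>x. det (g c (cinv c x))" "Ddet (cmap c p)"]
      det_has_derivative[OF p] e(2) by (simp add: o_def)
  then have "((\<lambda>_. 0) has_derivative (\<lambda>r. Ddet (cmap c p) (r *\<^sub>R u))) (at (0::real))"
  proof (rule has_derivative_transform_within_open)
    show "open {-e<..<e}" "0 \<in> {-e<..<e}" using e(1) by auto
    show "((\<lambda>x. det (g c (cinv c x))) \<circ> (cmap c \<circ> \<gamma>)) t = 0" if "t \<in> {-e<..<e}" for t
      using bspec[OF e(3) that] singular_set_iff_det[OF s(2,3)] chart_inverse(1)[OF smooth_structureD(1)[OF s(1,3)]]
      by auto
  qed
  from has_derivative_unique[OF this has_derivative_const] have "Ddet (cmap c p) (1 *\<^sub>R u) = 0"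
    by metis
  then show ?thesis by simp
qed

lemma det_gram:
  "det (gram g X Y c q) = (X c q \<bullet> (g c q *v X c q)) * (Y c q \<bullet> (g c q *v Y c q))
    - (X c q \<bullet> (g c q *v Y c q)) * (Y c q \<bullet> (g c q *v X c q))"
  by (simp add: gram_def det_2 metric_def)

section \<open>The contradiction at a point of the singular hypersurface\<close>

theorem proposition20:
  fixes \<Phi> :: "('a::{second_countable_topology, t2_space}, 'm::finite) chart set"
    and g :: "('a, 'm) tensor2"
    and A B N R :: "('a, 'm) vfield"
    and U S :: "'a set"
  assumes "transverse_singular_space \<Phi> g"
    and "riemann_lorentz \<Phi> g"
    and "tangent_radical \<Phi> g"
    and "open U" and "U \<subseteq> manifold_carrier \<Phi>"
    and "S = singular_set \<Phi> g \<inter> U" and "S \<noteq> {}"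
    and "main_normal \<Phi> g S N"
    and "main_radical \<Phi> g S N R"
    and "vector_field_along \<Phi> S A" and "vector_field_along \<Phi> S B"
    and "\<And>p c. p \<in> S \<Longrightarrow> c \<in> charts_at \<Phi> p \<Longrightarrow> dim (plane A B c p) = 2"
    and "\<And>p c. p \<in> S \<Longrightarrow> c \<in> charts_at \<Phi> p \<Longrightarrow> rank (gram g A B c p) = 1"
    and "\<And>p c. p \<in> S \<Longrightarrow> c \<in> charts_at \<Phi> p \<Longrightarrow> R c p \<in> plane A B c p"
  shows "\<not> curvature_well_defined \<Phi> g U A B"
proof
  let ?S = "singular_set \<Phi> g"
  have s: "smooth_structure \<Phi>" "symmetric_tensor_field \<Phi> g"
    using assms(1) unfolding transverse_singular_space_def by blast+
  assume "curvature_well_defined \<Phi> g U A B"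
  then obtain k where k: "\<forall>V X Y. V \<subseteq> U \<and> extension_on \<Phi> ?S V A X \<and> extension_on \<Phi> ?S V B Y \<longrightarrow>
      (\<exists>W F. open W \<and> V \<inter> ?S \<subseteq> W \<and> W \<subseteq> V \<and> smooth_function_on \<Phi> W F \<and>
           (\<forall>q\<in>W - ?S. \<forall>c\<in>charts_at \<Phi> q.
              det (gram g X Y c q) \<noteq> 0 \<longrightarrow> F q = sectional_curvature g X Y c q) \<and>
           (\<forall>q\<in>V \<inter> ?S. F q = k q))"
    unfolding curvature_well_defined_def Let_def ..
  obtain p where p: "p \<in> S" using assms(7) by blast
  then have pS: "p \<in> ?S" "p \<in> U" using assms(6) by auto
  then obtain c where c: "c \<in> \<Phi>" "p \<in> cdom c"
    using assms(5) unfolding manifold_carrier_def by blast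
  then have cp: "c \<in> charts_at \<Phi> p" by (simp add: charts_at_def)
  have chart: "is_chart c" by (rule smooth_structureD(1)[OF s(1) c(1)])
  obtain V1 X where X: "p \<in> V1" "extension_on \<Phi> S V1 A X"
    using assms(10) p unfolding vector_field_along_def by blast
  obtain V2 Y where Y: "p \<in> V2" "extension_on \<Phi> S V2 B Y"
    using assms(11) p unfolding vector_field_along_def by blast
  \<comment> \<open>Inside \<open>cdom c\<close> the coordinate fields of \<open>c\<close> are
    available; inside \<open>U\<close> the assumed well-definedness applies.\<close>
  define V where "V = V1 \<inter> V2 \<inter> U \<inter> cdom c"
  have V: "open V" "V \<subseteq> U" "V \<subseteq> cdom c" "p \<in> V" "V \<subseteq> manifold_carrier \<Phi>"
    using X Y assms(4,5) chart c pS unfolding V_def extension_on_def is_chart_def by auto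
  have XV: "vector_field_on \<Phi> V X" "\<And>q d. q \<in> V \<inter> ?S \<Longrightarrow> d \<in> charts_at \<Phi> q \<Longrightarrow> X d q = A d q"
    and YV: "vector_field_on \<Phi> V Y" "\<And>q d. q \<in> V \<inter> ?S \<Longrightarrow> d \<in> charts_at \<Phi> q \<Longrightarrow> Y d q = B d q"
    using X(2) Y(2) assms(6) vector_field_on_subset[of \<Phi> V1 X V] vector_field_on_subset[of \<Phi> V2 Y V]
    unfolding extension_on_def V_def by auto
  let ?G = "\<lambda>x. g c (cinv c x)"
  let ?x = "cmap c p"
  interpret coordinate_metric ?G "cmap c ` cdom c"
    by (rule coordinate_metric_chart[OF s c(1)])
  have inv: "cinv c ?x = p" by (rule chart_inverse(1)[OF chart c(2)])
  have x: "?x \<in> cmap c ` cdom c" using c by blast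
  have det0: "det (?G ?x) = 0"
    using singular_set_iff_det[OF s(2) c] pS(1) by (simp add: inv)
  obtain z where z: "Ddet ?x z \<noteq> 0"
    using assms(1) pS(1) cp unfolding transverse_singular_space_def by blast
  have psd: "0 \<le> v \<bullet> (g c p *v v)" for v
    using closure_riemannian_semidefinite[OF s c] assms(2) pS(1)
    unfolding riemann_lorentz_def Let_def by blast
  have sym: "transpose (g c p) = g c p" using symmetric[OF x] by (simp add: inv)
  have A: "X c p = A c p" and B: "Y c p = B c p"
    using XV(2) YV(2) V(4) pS(1) cp by auto
  obtain a b where ab: "(a, b) \<noteq> (0, 0)" "g c p *v (a *\<^sub>R A c p + b *\<^sub>R B c p) = 0"
    and trace: "A c p \<bullet> (g c p *v A c p) + B c p \<bullet> (g c p *v B c p) \<noteq> 0"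
    using rank_one_gram_kernel[OF sym psd] assms(13)[OF p cp] unfolding gram_def metric_def by metis
  define u where "u = a *\<^sub>R A c p + b *\<^sub>R B c p"
  have u0: "u \<noteq> 0"
    using dim_span_pair_independent[of "A c p" "B c p" a b] assms(12)[OF p cp] ab(1)
    unfolding u_def plane_def by blast
  have "w \<bullet> (g c p *v v) = v \<bullet> (g c p *v w)" for v w
    using G_inner_commute[OF x] by (simp add: inv)
  then have "u \<in> radical g c p" using ab(2) by (simp add: radical_def u_def)
  then have "u \<in> tangent_space ?S c p"
    using assms(3) pS(1) cp unfolding tangent_radical_def by blast
  then have Du: "Ddet ?x u = 0" by (rule tangent_det_derivative[OF s c(1)])

  let ?Z = "coordinate_field c z"
  \<comment> \<open>The determinant is taken in the fixed chart \<open>c\<close>, whatever the chart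
    \<open>d\<close>. It vanishes on the singular set, so these fields still extend \<open>A\<close>
    and \<open>B\<close>.\<close>
  define Xs where "Xs r d q = X d q + (r * det (g c q) * b) *\<^sub>R ?Z d q" for r d q
  define Ys where "Ys r d q = Y d q + (r * det (g c q) * (- a)) *\<^sub>R ?Z d q" for r d q
  have ZV: "vector_field_on \<Phi> V ?Z" by (rule vector_field_coordinate_field[OF s(1) c(1) V(3,1)])
  have vs: "vector_field_on \<Phi> V (Xs r)" "vector_field_on \<Phi> V (Ys r)" for r
    unfolding Xs_def Ys_def
    by (intro vector_field_on_add_scaleR[OF s(1) V(1) _ ZV] XV YV smooth_function_det_metric[OF s c(1) V(3)])+
  have ext: "extension_on \<Phi> ?S V A (Xs r)" "extension_on \<Phi> ?S V B (Ys r)" for r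
    using V vs XV(2) YV(2) singular_set_iff_det[OF s(2) c(1)]
    unfolding extension_on_def by (auto simp: Xs_def Ys_def)
  \<comment> \<open>\<open>k\<close> was fixed before the extensions, whereas \<open>W\<close> and
    \<open>F\<close> may depend on \<open>r\<close>. Hence the curvatures for all \<open>r\<close>
    share the limit \<open>k p\<close>.\<close>
  have "\<forall>r. \<exists>W F. open W \<and> V \<inter> ?S \<subseteq> W \<and> W \<subseteq> V \<and> smooth_function_on \<Phi> W F \<and>
           (\<forall>q\<in>W - ?S. \<forall>c\<in>charts_at \<Phi> q.
              det (gram g (Xs r) (Ys r) c q) \<noteq> 0 \<longrightarrow> F q = sectional_curvature g (Xs r) (Ys r) c q) \<and>
           (\<forall>q\<in>V \<inter> ?S. F q = k q)"
    using V(2) ext by (intro allI k[rule_format]) blast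
  then obtain W F where W: "\<And>r. open (W r)" "\<And>r. V \<inter> ?S \<subseteq> W r" "\<And>r. W r \<subseteq> V"
    and F: "\<And>r. smooth_function_on \<Phi> (W r) (F r)"
      "\<And>r q c. q \<in> W r - ?S \<Longrightarrow> c \<in> charts_at \<Phi> q \<Longrightarrow> det (gram g (Xs r) (Ys r) c q) \<noteq> 0 \<Longrightarrow>
         F r q = sectional_curvature g (Xs r) (Ys r) c q"
      "\<And>r q. q \<in> V \<inter> ?S \<Longrightarrow> F r q = k q"
    by metis
  have sm: "smooth_on (cmap c ` V) (H c \<circ> cinv c)" if "vector_field_on \<Phi> V H" for H
    using that c(1) V(3) unfolding vector_field_on_def by (metis Int_absorb1)
  have xV: "?x \<in> cmap c ` V" using V(4) by blast
  let ?q = "\<lambda>t. cinv c (?x + t *\<^sub>R z)"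
  have near: "eventually (\<lambda>t. ?x + t *\<^sub>R z \<in> cmap c ` (cdom c \<inter> W r)) (at 0)" for r
    by (rule eventually_line_in[OF open_chart_image[OF chart W(1)]]) (use W(2) V(4) pS c in blast)
  let ?Xs = "\<lambda>r y. (X c \<circ> cinv c) y + (r * det (?G y) * b) *\<^sub>R z"
  let ?Ys = "\<lambda>r y. (Y c \<circ> cinv c) y - (r * det (?G y) * a) *\<^sub>R z"
  show False
  proof (rule curvature_quotients_differ[of ?x z "X c \<circ> cinv c" "Y c \<circ> cinv c" a b u ?Xs ?Ys "\<lambda>r t. F r (?q t)" "k p"])
    show "?x \<in> cmap c ` cdom c" "det (?G ?x) = 0" "Ddet ?x z \<noteq> 0" "(a, b) \<noteq> (0, 0)" "u \<noteq> 0" "Ddet ?x u = 0"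
      by (fact x det0 z ab(1) u0 Du)+
    show "X c \<circ> cinv c differentiable at ?x" "Y c \<circ> cinv c differentiable at ?x"
      using smooth_on_has_derivative[OF sm[OF XV(1)] xV] smooth_on_has_derivative[OF sm[OF YV(1)] xV]
      by (auto intro: differentiableI)
    show "?G ?x *v u = 0" "u = a *\<^sub>R (X c \<circ> cinv c) ?x + b *\<^sub>R (Y c \<circ> cinv c) ?x"
      "(X c \<circ> cinv c) ?x \<bullet> (?G ?x *v (X c \<circ> cinv c) ?x) + (Y c \<circ> cinv c) ?x \<bullet> (?G ?x *v (Y c \<circ> cinv c) ?x) \<noteq> 0"
      using ab(2) trace by (simp_all add: u_def inv A B)
  next
    fix r :: real
    \<comment> \<open>Continuity carries the value of \<open>F r\<close> at \<open>p\<close> to the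
      limit along the line, where the quotient itself cannot be evaluated at
      \<open>t = 0\<close>.\<close>
    have "smooth_on (cmap c ` (cdom c \<inter> W r)) (F r \<circ> cinv c)"
      using F(1) c(1) unfolding smooth_function_on_def by blast
    moreover have "?x \<in> cmap c ` (cdom c \<inter> W r)" using W(2) V(4) pS c by blast
    ultimately have "isCont (F r \<circ> cinv c) ?x"
      using smooth_on_continuous open_chart_image[OF chart W(1)] continuous_on_eq_continuous_at by blast
    from isCont_tendsto_compose[OF this tendsto_line[of _ z]]
    show "((\<lambda>t. F r (?q t)) \<longlongrightarrow> k p) (at 0)"
      using F(3)[of p r] V(4) pS(1) by (simp add: inv)
  next
    fix r :: real
    \<comment> \<open>Near \<open>t = 0\<close> the punctured line runs inside \<open>W r\<close>
      and off the singular set, where \<open>F r\<close> is the sectional curvature if the Gram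
      determinant is nonzero.\<close>
    show "eventually (\<lambda>t. gram_det (?x + t *\<^sub>R z) (?Xs r (?x + t *\<^sub>R z)) (?Ys r (?x + t *\<^sub>R z)) \<noteq> 0 \<longrightarrow>
        F r (?q t) = riem (?x + t *\<^sub>R z) (?Xs r (?x + t *\<^sub>R z)) (?Ys r (?x + t *\<^sub>R z)) (?Xs r (?x + t *\<^sub>R z)) (?Ys r (?x + t *\<^sub>R z))
          / gram_det (?x + t *\<^sub>R z) (?Xs r (?x + t *\<^sub>R z)) (?Ys r (?x + t *\<^sub>R z))) (at 0)"
      using near[of r] eventually_det_nonzero[OF x det0 z]
    proof eventually_elim
      case (elim t)
      have q: "?q t \<in> W r" "?q t \<in> cdom c" "cmap c (?q t) = ?x + t *\<^sub>R z"
        using elim(1) chart_inverse[OF chart] by auto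
      then have qV: "?q t \<in> V" using W(3) by blast
      have qS: "?q t \<in> W r - ?S" "c \<in> charts_at \<Phi> (?q t)"
        using singular_set_iff_det[OF s(2) c(1) q(2)] elim(2) q c(1) by (auto simp: charts_at_def)
      have fields: "?Xs r (?x + t *\<^sub>R z) = Xs r c (?q t)" "?Ys r (?x + t *\<^sub>R z) = Ys r c (?q t)"
        by (simp_all add: Xs_def Ys_def coordinate_field_self[OF s(1) c(1) q(2)])
      have gr: "gram_det (?x + t *\<^sub>R z) (Xs r c (?q t)) (Ys r c (?q t)) = det (gram g (Xs r) (Ys r) c (?q t))"
        by (simp add: gram_det_def det_gram)
      have "metric g (curvature g (Xs r) (Ys r) (Xs r)) (Ys r) c (?q t)
        = riem (?x + t *\<^sub>R z) (Xs r c (?q t)) (Ys r c (?q t)) (Xs r c (?q t)) (Ys r c (?q t))"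
        using metric_curvature_coordinates[where g = g and X = "Xs r" and Y = "Ys r" and Z = "Xs r", OF chart coordinate_metric_axioms V(1,3) qV elim(2)
            sm[OF vs(1)] sm[OF vs(2)] sm[OF vs(1)]] by (simp add: q(3))
      then show ?case unfolding fields gr using F(2)[OF qS] by (simp add: sectional_curvature_def)
    qed
  qed auto
qed

end
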